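(* Let $\mathcal{S}=\{(1,b_1),\dots,(1,b_m)\}$ be a set of steps with distinct $b_\ell\in\mathbb{Z}$, with positive real weights $w_1,\dots,w_m$, characteristic polynomial $P(X)=\sum_{\ell=1}^m w_\ell X^{b_\ell}$, and $c=-\min_\ell b_\ell\ge1$. For $j\ge0$, the generating function $T_j(z,v)$ of weighted meanders with these steps and weights starting at level $j$, where $z$ marks the length and $v$ marks the level of the endpoint relative to the starting level (end level minus $j$), is given by $$T_j(z,v)=\frac{1}{1-zP(v)}\Big(\sum_{f=0}^{j}h_f\Big(\frac{X_1}{v},\dots,\frac{X_c}{v}\Big)\Big)\prod_{\ell=1}^{c}\Big(1-\frac{X_\ell}{v}\Big),$$ where $X_1,\dots,X_c$ are the small solutions of $1-zP(X)=0$ and $h_f(x_1,\dots,x_c)=\sum_{1\le i_1\le\dots\le i_f\le c}\prod_{\ell=1}^f x_{i_\ell}$ are the complete homogeneous symmetric polynomials.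
   Context: A meander of length $n$ starting at level $j\ge0$ is a lattice path $(0,j)=p_0,p_1,\dots,p_n$ with $p_i-p_{i-1}\in\mathcal{S}$ for all $i$ whose points all have nonnegative second coordinate. The weight of a path is the product of the weights of its steps (step $(1,b_\ell)$ has weight $w_\ell$). $T_j(z,v)=\sum_{\text{meanders }\pi}\mathrm{weight}(\pi)\,z^{\mathrm{length}(\pi)}v^{\mathrm{endlevel}(\pi)-j}$, a power series in $z$ with coefficients in $\mathbb{R}[v,v^{-1}]$. The small solutions $X_1,\dots,X_c$ are the $c$ Puiseux series solutions $X\in\bigcup_{m\ge1}\mathbb{C}((z^{1/m}))$ of $1-zP(X)=0$ with positive order in $z$ (i.e. tending to $0$ as $z\to 0$). The identity is in $\bigcup_{m\ge1}\mathbb{C}[v,v^{-1}]((z^{1/m}))$. *)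

theory Defs
  imports
    Complex_Main
    "HOL-Computational_Algebra.Formal_Laurent_Series"
    "HOL-Library.Poly_Mapping"
    "HOL-Library.Product_Plus"
begin

text \<open>
  The elements of the union over all \<^term>\<open>N \<ge> (1::nat)\<close> of the Laurent series in \<open>z\<^sup>1\<^sup>/\<^sup>N\<close>
  with coefficients in \<^typ>\<open>'a\<close>, represented by their coefficient functions on rational exponents.
\<close>

definition is_puiseux :: "(rat \<Rightarrow> 'a::zero) \<Rightarrow> bool" where
  "is_puiseux f \<longleftrightarrow>
     (\<exists>N>0::nat. \<exists>k0::int. \<forall>q. f q \<noteq> 0 \<longrightarrow> (\<exists>k\<ge>k0. q = of_int k / of_nat N))"

typedef (overloaded) 'a puiseux = "{f :: rat \<Rightarrow> 'a::zero. is_puiseux f}"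
  morphisms puiseux_nth Abs_puiseux
  by (rule exI[of _ "\<lambda>_. 0"]) (auto simp: is_puiseux_def)

setup_lifting type_definition_puiseux

definition fls_spread :: "nat \<Rightarrow> 'a::zero fls \<Rightarrow> rat \<Rightarrow> 'a" where
  "fls_spread N F q =
     (if N > 0 \<and> of_nat N * q \<in> \<int> then fls_nth F \<lfloor>of_nat N * q\<rfloor> else 0)"

lemma fls_spread_of_int [simp]: "N > 0 \<Longrightarrow> fls_spread N F (of_int k / of_nat N) = fls_nth F k"
  by (simp add: fls_spread_def)

lemma fls_spread_nonzeroE:
  assumes "fls_spread N F q \<noteq> 0"
  obtains k where "q = of_int k / of_nat N" "fls_nth F k \<noteq> 0" "N > 0"
proof -
  from assms have N: "N > 0" and "of_nat N * q \<in> \<int>" by (auto simp: fls_spread_def split: if_splits)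
  then obtain k where k: "of_nat N * q = of_int k" by (auto elim: Ints_cases)
  with N have q: "q = of_int k / of_nat N" by (simp add: field_simps)
  with assms N show ?thesis by (intro that[of k]) auto
qed

lemma is_puiseux_fls_spread: "is_puiseux (fls_spread N F)"
proof (cases "N > 0")
  case True
  obtain k0 where k0: "\<forall>n<k0. fls_nth F n = 0" by (elim fls_nth_vanishes_belowE)
  have "\<exists>k\<ge>k0. q = of_int k / of_nat N" if "fls_spread N F q \<noteq> 0" for q
    using that k0 by (metis fls_spread_nonzeroE linorder_not_less)
  with True show ?thesis unfolding is_puiseux_def by blast
next
  case False
  then show ?thesis by (auto simp: is_puiseux_def fls_spread_def)
qed

lemma fls_spread_eqI:
  assumes N: "N > 0"
    and supp: "\<And>q. f q \<noteq> 0 \<Longrightarrow> \<exists>k. q = of_int k / of_nat N"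
    and F: "\<And>k. fls_nth F k = f (of_int k / of_nat N)"
  shows "f = fls_spread N F"
proof
  fix q
  show "f q = fls_spread N F q"
  proof (cases "\<exists>k. q = of_int k / of_nat N")
    case True
    then show ?thesis using N F by auto
  next
    case False
    then have "f q = 0" using supp by blast
    moreover have "fls_spread N F q = 0" using False by (metis fls_spread_nonzeroE)
    ultimately show ?thesis by simp
  qed
qed

lemma fls_spread_exists:
  assumes N: "N > 0" and supp: "\<And>q. f q \<noteq> 0 \<Longrightarrow> \<exists>k\<ge>k0. q = of_int k / of_nat N"
  shows "\<exists>F. f = fls_spread N F"
proof -
  have "f (of_int k / of_nat N) = 0" if "k < k0" for k
  proof (rule ccontr)
    assume "f (of_int k / of_nat N) \<noteq> 0"
    then obtain l where "l \<ge> k0" "of_int k / of_nat N = (of_int l / of_nat N :: rat)"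
      using supp by blast
    then show False using N that by simp
  qed
  then have "fls_nth (Abs_fls (\<lambda>k. f (of_int k / of_nat N))) k = f (of_int k / of_nat N)" for k
    by (intro nth_Abs_fls_ex_lower_bound) blast
  then show ?thesis using fls_spread_eqI[OF N, of f] supp by blast
qed

lemma fls_spread_refine:
  assumes "N > 0" "M > 0"
  shows "\<exists>G. fls_spread N F = fls_spread (N * M) G"
proof -
  obtain k0 where k0: "\<forall>n<k0. fls_nth F n = 0" by (elim fls_nth_vanishes_belowE)
  show ?thesis
  proof (rule fls_spread_exists)
    show "N * M > 0" using assms by simp
    fix q assume "fls_spread N F q \<noteq> 0"
    then obtain k where k: "q = of_int k / of_nat N" "fls_nth F k \<noteq> 0" by (elim fls_spread_nonzeroE)
    then have "k \<ge> k0" using k0 by (metis linorder_not_less)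
    then have "k * int M \<ge> k0 * int M" by (simp add: mult_right_mono)
    moreover have "q = of_int (k * int M) / of_nat (N * M)" using k assms by simp
    ultimately show "\<exists>k\<ge>k0 * int M. q = of_int k / of_nat (N * M)" by blast
  qed
qed

lemma is_puiseuxE:
  assumes "is_puiseux f"
  obtains N F where "N > 0" "f = fls_spread N F"
proof -
  from assms obtain N k0
    where N: "N > 0" and "\<And>q. f q \<noteq> 0 \<Longrightarrow> (\<exists>k\<ge>k0. q = of_int k / of_nat N)"
    unfolding is_puiseux_def by blast
  then have "\<exists>F. f = fls_spread N F" by (rule fls_spread_exists)
  with N that show ?thesis by blast
qed

lemma is_puiseux2E:
  assumes "is_puiseux f" "is_puiseux g"
  obtains N F G where "N > 0" "f = fls_spread N F" "g = fls_spread N G"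
proof -
  obtain N F where N: "N > 0" "f = fls_spread N F" using assms(1) by (rule is_puiseuxE)
  obtain M G where M: "M > 0" "g = fls_spread M G" using assms(2) by (rule is_puiseuxE)
  obtain F' where "f = fls_spread (N * M) F'" using fls_spread_refine[OF N(1) M(1)] N(2) by blast
  moreover obtain G' where "g = fls_spread (N * M) G'"
    using fls_spread_refine[OF M(1) N(1)] M(2) by (metis mult.commute)
  ultimately show ?thesis using that[of "N * M"] N(1) M(1) by simp
qed

definition puiseux_conv :: "(rat \<Rightarrow> 'a::comm_ring_1) \<Rightarrow> (rat \<Rightarrow> 'a) \<Rightarrow> rat \<Rightarrow> 'a" where
  "puiseux_conv f g q = (\<Sum>p | f p \<noteq> 0 \<and> g (q - p) \<noteq> 0. f p * g (q - p))"

lemma puiseux_conv_fls_spread: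
  assumes N: "N > 0"
  shows "puiseux_conv (fls_spread N F) (fls_spread N G) = fls_spread N (F * G)"
proof (rule fls_spread_eqI[OF N])
  fix q assume "puiseux_conv (fls_spread N F) (fls_spread N G) q \<noteq> 0"
  then obtain p where p: "fls_spread N F p \<noteq> 0" "fls_spread N G (q - p) \<noteq> 0"
    unfolding puiseux_conv_def by (elim sum.not_neutral_contains_not_neutral) auto
  obtain k where k: "p = of_int k / of_nat N" using p(1) by (elim fls_spread_nonzeroE)
  obtain l where l: "q - p = of_int l / of_nat N" using p(2) by (elim fls_spread_nonzeroE)
  have "q = p + (q - p)" by simp
  also have "\<dots> = of_int (k + l) / of_nat N" unfolding l by (simp add: k add_divide_distrib)
  finally show "\<exists>k. q = of_int k / of_nat N" by blast
next
  fix n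
  let ?q = "of_int n / of_nat N :: rat"
  let ?h = "\<lambda>i::int. of_int i / of_nat N :: rat"
  define I where "I = {i. fls_nth F i \<noteq> 0 \<and> fls_nth G (n - i) \<noteq> 0}"
  have sub: "fls_spread N G (?q - ?h i) = fls_nth G (n - i)" for i
    using N by (metis diff_divide_distrib fls_spread_of_int of_int_diff)
  have eq: "{p. fls_spread N F p \<noteq> 0 \<and> fls_spread N G (?q - p) \<noteq> 0} = ?h ` I"
  proof (intro set_eqI iffI)
    fix p assume "p \<in> {p. fls_spread N F p \<noteq> 0 \<and> fls_spread N G (?q - p) \<noteq> 0}"
    then have p: "fls_spread N F p \<noteq> 0" "fls_spread N G (?q - p) \<noteq> 0" by auto
    obtain k where k: "p = ?h k" "fls_nth F k \<noteq> 0" using p(1) by (elim fls_spread_nonzeroE)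
    with p(2) sub have "fls_nth G (n - k) \<noteq> 0" by simp
    with k show "p \<in> ?h ` I" by (auto simp: I_def)
  qed (use N sub in \<open>auto simp: I_def\<close>)
  have inj: "inj_on ?h I" using N by (auto intro: inj_onI)
  have "puiseux_conv (fls_spread N F) (fls_spread N G) ?q =
      (\<Sum>i\<in>I. fls_nth F i * fls_nth G (n - i))"
    unfolding puiseux_conv_def eq by (simp add: sum.reindex[OF inj] sub N)
  also have "\<dots> = (\<Sum>i=fls_subdegree F..n - fls_subdegree G. fls_nth F i * fls_nth G (n - i))"
  proof (rule sum.mono_neutral_left)
    show "I \<subseteq> {fls_subdegree F..n - fls_subdegree G}"
    proof
      fix i assume "i \<in> I"
      then have "fls_subdegree F \<le> i" "fls_subdegree G \<le> n - i"
        by (auto simp: I_def intro: fls_subdegree_leI)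
      then show "i \<in> {fls_subdegree F..n - fls_subdegree G}" by simp
    qed
  qed (auto simp: I_def)
  also have "\<dots> = fls_nth (F * G) n" by (rule fls_times_nth(2)[symmetric])
  finally show "fls_nth (F * G) n = puiseux_conv (fls_spread N F) (fls_spread N G) ?q" ..
qed

lemma fls_spread_add: "(\<lambda>q. fls_spread N F q + fls_spread N G q) = fls_spread N (F + G)"
  for F G :: "'a::comm_ring_1 fls"
  by (auto simp: fls_spread_def)

lemma fls_spread_uminus: "(\<lambda>q. - fls_spread N F q) = fls_spread N (- F)"
  for F :: "'a::comm_ring_1 fls"
  by (auto simp: fls_spread_def)

lemma fls_spread_minus: "(\<lambda>q. fls_spread N F q - fls_spread N G q) = fls_spread N (F - G)"
  for F G :: "'a::comm_ring_1 fls"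
  by (auto simp: fls_spread_def)

lemma fls_spread_0: "fls_spread N 0 = (\<lambda>_. 0)"
  by (auto simp: fls_spread_def)

lemma fls_spread_1: "N > 0 \<Longrightarrow> (\<lambda>q. if q = 0 then 1 else 0) = fls_spread N (1 :: 'a::comm_ring_1 fls)"
  by (rule fls_spread_eqI) (auto split: if_splits intro: exI[of _ 0])

text \<open>The Laurent series \<open>F\<close> in \<open>t\<close>, read as a Puiseux series via \<open>t = z\<^sup>1\<^sup>/\<^sup>N\<close> (for \<open>N > 0\<close>).\<close>

lift_definition puiseux_of_fls :: "nat \<Rightarrow> 'a::zero fls \<Rightarrow> 'a puiseux" is fls_spread
  by (rule is_puiseux_fls_spread)

instantiation puiseux :: (comm_ring_1) comm_ring_1
begin

lift_definition zero_puiseux :: "'a puiseux" is "\<lambda>_. 0"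
  by (auto simp: is_puiseux_def)

lift_definition one_puiseux :: "'a puiseux" is "\<lambda>q. if q = 0 then 1 else 0"
  by (metis (no_types) fls_spread_1 is_puiseux_fls_spread zero_less_one)

lift_definition plus_puiseux :: "'a puiseux \<Rightarrow> 'a puiseux \<Rightarrow> 'a puiseux" is "\<lambda>f g q. f q + g q"
  by (erule (1) is_puiseux2E) (simp add: fls_spread_add is_puiseux_fls_spread)

lift_definition uminus_puiseux :: "'a puiseux \<Rightarrow> 'a puiseux" is "\<lambda>f q. - f q"
  by (elim is_puiseuxE) (simp add: fls_spread_uminus is_puiseux_fls_spread)

lift_definition minus_puiseux :: "'a puiseux \<Rightarrow> 'a puiseux \<Rightarrow> 'a puiseux" is "\<lambda>f g q. f q - g q"
  by (erule (1) is_puiseux2E) (simp add: fls_spread_minus is_puiseux_fls_spread)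

lift_definition times_puiseux :: "'a puiseux \<Rightarrow> 'a puiseux \<Rightarrow> 'a puiseux" is puiseux_conv
  by (erule (1) is_puiseux2E) (simp add: puiseux_conv_fls_spread is_puiseux_fls_spread)

lemma puiseux_of_fls_add: "puiseux_of_fls N (F + G) = puiseux_of_fls N F + puiseux_of_fls N G"
  for F G :: "'a fls"
  by transfer (simp add: fls_spread_add)

lemma puiseux_of_fls_mult:
  "N > 0 \<Longrightarrow> puiseux_of_fls N (F * G) = puiseux_of_fls N F * puiseux_of_fls N G"
  for F G :: "'a fls"
  by transfer (simp add: puiseux_conv_fls_spread)

lemma puiseux_of_fls_1: "N > 0 \<Longrightarrow> puiseux_of_fls N (1 :: 'a fls) = 1"
  by transfer (simp add: fls_spread_1)

lemma puiseux_of_fls_0: "puiseux_of_fls N (0 :: 'a fls) = 0"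
  by transfer (simp add: fls_spread_0)

lemma puiseux_cases:
  fixes x :: "'a puiseux"
  obtains N F where "N > 0" "x = puiseux_of_fls N F"
proof -
  have "\<exists>N>0. \<exists>F. x = puiseux_of_fls N F"
    by transfer (metis is_puiseuxE)
  with that show ?thesis by blast
qed

lemma puiseux_cases2:
  fixes x y :: "'a puiseux"
  obtains N F G where "N > 0" "x = puiseux_of_fls N F" "y = puiseux_of_fls N G"
proof -
  have "\<exists>N>0. \<exists>F G. x = puiseux_of_fls N F \<and> y = puiseux_of_fls N G"
    by transfer (metis is_puiseux2E)
  with that show ?thesis by blast
qed

lemma puiseux_of_fls_refine:
  fixes F :: "'a fls"
  assumes "N > 0" "M > 0"
  obtains G where "puiseux_of_fls N F = puiseux_of_fls (N * M) G"
proof -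
  have "\<exists>G. puiseux_of_fls N F = puiseux_of_fls (N * M) G"
    using assms by transfer (rule fls_spread_refine)
  with that show ?thesis by blast
qed

lemma puiseux_cases3:
  fixes x y z :: "'a puiseux"
  obtains N F G H
  where "N > 0" "x = puiseux_of_fls N F" "y = puiseux_of_fls N G" "z = puiseux_of_fls N H"
proof -
  obtain N F G where N: "N > 0" "x = puiseux_of_fls N F" "y = puiseux_of_fls N G"
    by (rule puiseux_cases2)
  obtain M H where M: "M > 0" "z = puiseux_of_fls M H" by (rule puiseux_cases)
  obtain F' where "x = puiseux_of_fls (N * M) F'" using N M by (metis puiseux_of_fls_refine)
  moreover obtain G' where "y = puiseux_of_fls (N * M) G'" using N M by (metis puiseux_of_fls_refine)
  moreover obtain H' where "z = puiseux_of_fls (N * M) H'"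
    using N M by (metis puiseux_of_fls_refine mult.commute)
  ultimately show ?thesis using that[of "N * M"] N(1) M(1) by simp
qed

instance
proof
  fix a b c :: "'a puiseux"
  show "a + b + c = a + (b + c)" by transfer (simp add: add.assoc)
  show "a + b = b + a" by transfer (simp add: add.commute)
  show "0 + a = a" by transfer simp
  show "- a + a = 0" by transfer simp
  show "a - b = a + - b" by transfer simp
  obtain N F G H where N: "N > 0"
    and eq: "a = puiseux_of_fls N F" "b = puiseux_of_fls N G" "c = puiseux_of_fls N H"
    by (rule puiseux_cases3)
  note hom = puiseux_of_fls_mult[OF N, symmetric] puiseux_of_fls_add[symmetric]
    puiseux_of_fls_1[OF N, symmetric]
  show "a * b * c = a * (b * c)" unfolding eq hom by (simp add: mult.assoc)
  show "a * b = b * a" unfolding eq hom by (simp add: mult.commute)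
  show "1 * a = a" unfolding eq hom by simp
  show "(a + b) * c = a * c + b * c" unfolding eq hom by (simp add: distrib_right)
  show "(0 :: 'a puiseux) \<noteq> 1" by transfer (metis zero_neq_one)
qed

end

text \<open>
  Inverses are available over every commutative coefficient ring, with value \<open>0\<close> at non-units;
  over a field this makes the Puiseux series a field. Over the Laurent polynomials in \<open>v\<close>, both
  \<open>v\<close> and \<open>1 - z P(v)\<close> (a power series in \<open>z\<close> with constant term \<open>1\<close>) are units.
\<close>

instantiation puiseux :: (comm_ring_1) inverse
begin

definition inverse_puiseux :: "'a puiseux \<Rightarrow> 'a puiseux" where
  "inverse_puiseux x = (if \<exists>y. x * y = 1 then THE y. x * y = 1 else 0)"

definition divide_puiseux :: "'a puiseux \<Rightarrow> 'a puiseux \<Rightarrow> 'a puiseux" where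
  "divide_puiseux x y = x * inverse y"

instance ..

end

lemma puiseux_inverse_unique:
  fixes x y :: "'a::comm_ring_1 puiseux"
  assumes "x * y = 1"
  shows "inverse x = y"
proof -
  have "y' = y" if "x * y' = 1" for y'
    using assms that by (metis mult.assoc mult.commute mult.right_neutral)
  then have "(THE y. x * y = 1) = y" using assms by (rule the_equality[rotated])
  then show ?thesis using assms by (auto simp: inverse_puiseux_def)
qed

instance puiseux :: (field) field
proof
  fix x y :: "'a puiseux"
  show "inverse x * x = 1" if "x \<noteq> 0"
  proof -
    obtain N F where N: "N > 0" and x: "x = puiseux_of_fls N F" by (rule puiseux_cases)
    with that have "F \<noteq> 0" by (auto simp: puiseux_of_fls_0)
    then have "x * puiseux_of_fls N (inverse F) = 1"
      unfolding x puiseux_of_fls_mult[OF N, symmetric] by (simp add: puiseux_of_fls_1[OF N])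
    then show ?thesis using puiseux_inverse_unique by (metis mult.commute)
  qed
  show "x div y = x * inverse y" by (rule divide_puiseux_def)
  have "\<nexists>y. (0 :: 'a puiseux) * y = 1" by simp
  then show "inverse (0 :: 'a puiseux) = 0" unfolding inverse_puiseux_def by simp
qed

lift_definition map_puiseux :: "('a::zero \<Rightarrow> 'b::zero) \<Rightarrow> 'a puiseux \<Rightarrow> 'b puiseux"
  is "\<lambda>h f q. if f q = 0 then 0 else h (f q)"
  unfolding is_puiseux_def by metis

definition puiseux_const :: "'a::zero \<Rightarrow> 'a puiseux" where
  "puiseux_const a = puiseux_of_fls 1 (fls_const a)"

definition puiseux_Z :: "'a::{zero,one} puiseux" where
  "puiseux_Z = puiseux_of_fls 1 fls_X"

definition puiseux_pos_order :: "'a::zero puiseux \<Rightarrow> bool" where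
  "puiseux_pos_order x \<longleftrightarrow> (\<forall>q. puiseux_nth x q \<noteq> 0 \<longrightarrow> q > 0)"

text \<open>The ring of Laurent polynomials in \<open>v\<close> is the group algebra of the integers.\<close>

type_synonym 'a laurent_poly = "int \<Rightarrow>\<^sub>0 'a"

definition puiseux_v :: "complex laurent_poly puiseux" where
  "puiseux_v = puiseux_const (Poly_Mapping.single 1 1)"

definition lift_v :: "complex puiseux \<Rightarrow> complex laurent_poly puiseux" where
  "lift_v = map_puiseux (Poly_Mapping.single 0)"

text \<open>
  A finite set \<open>B\<close> of integers stands for the set of steps \<open>{1} \<times> B\<close>, and \<open>w b\<close> is the
  weight of the step \<open>(1, b)\<close>. Paths are the lists of their points.
\<close>

definition is_meander :: "(int \<times> int) set \<Rightarrow> nat \<Rightarrow> (int \<times> int) list \<Rightarrow> bool" where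
  "is_meander S j p \<longleftrightarrow>
     p \<noteq> [] \<and> hd p = (0, int j) \<and>
     (\<forall>i. Suc i < length p \<longrightarrow> p ! Suc i - p ! i \<in> S) \<and>
     (\<forall>q\<in>set p. snd q \<ge> 0)"

definition path_length :: "(int \<times> int) list \<Rightarrow> nat" where
  "path_length p = length p - 1"

definition path_weight :: "(int \<Rightarrow> real) \<Rightarrow> (int \<times> int) list \<Rightarrow> real" where
  "path_weight w p = (\<Prod>i<path_length p. w (snd (p ! Suc i - p ! i)))"

definition end_level :: "(int \<times> int) list \<Rightarrow> int" where
  "end_level p = snd (last p)"

definition meander_gf :: "int set \<Rightarrow> (int \<Rightarrow> real) \<Rightarrow> nat \<Rightarrow> real laurent_poly fps" where
  "meander_gf B w j = Abs_fps (\<lambda>n.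
     \<Sum>p | is_meander ({1} \<times> B) j p \<and> path_length p = n.
       Poly_Mapping.single (end_level p - int j) (path_weight w p))"

definition puiseux_of_real_gf :: "real laurent_poly fps \<Rightarrow> complex laurent_poly puiseux" where
  "puiseux_of_real_gf T =
     map_puiseux (Poly_Mapping.map complex_of_real) (puiseux_of_fls 1 (fps_to_fls T))"

text \<open>
  \<open>P(X) = \<Sum>b\<in>B. w b * X\<^sup>b\<close> is evaluated both at complex Puiseux series and at \<open>v\<close> in the Puiseux
  series over Laurent polynomials, so the weights enter through their images \<open>a b\<close> in the ring at hand.
\<close>

definition step_char_poly ::
  "int set \<Rightarrow> (int \<Rightarrow> 'a::comm_ring_1 puiseux) \<Rightarrow> 'a puiseux \<Rightarrow> 'a puiseux" where
  "step_char_poly B a x = (\<Sum>b\<in>B. a b * x powi b)"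

definition real_const :: "real \<Rightarrow> complex puiseux" where
  "real_const r = puiseux_const (complex_of_real r)"

definition small_solutions :: "int set \<Rightarrow> (int \<Rightarrow> real) \<Rightarrow> complex puiseux set" where
  "small_solutions B w =
     {X. X \<noteq> 0 \<and> puiseux_pos_order X \<and> 1 - puiseux_Z * step_char_poly B (\<lambda>b. real_const (w b)) X = 0}"

definition complete_homogeneous :: "nat \<Rightarrow> nat \<Rightarrow> (nat \<Rightarrow> 'a::comm_ring_1) \<Rightarrow> 'a" where
  "complete_homogeneous c f x =
     (\<Sum>is | length is = f \<and> sorted is \<and> set is \<subseteq> {1..c}. prod_list (map x is))"

end

theory Submission
  imports Defs
begin

text \<open>
  Put \<open>z = t\<^sup>c\<close> and work with power series in \<open>t\<close> over the Laurent polynomials in \<open>v\<close>. The kernel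
  equation \<open>X\<^sup>c = t\<^sup>c Q(X)\<close> has \<open>c\<close> distinct power series solutions without constant term, and
  dividing them out gives \<open>1 - z P(v) = \<Pi>(v) U(v)\<close> with \<open>\<Pi>(v)\<close> the product of the \<open>1 - X\<^sub>l/v\<close> and
  \<open>U\<close> a polynomial in \<open>v\<close>. The constant term of \<open>U\<close> is a unit, so there are no other small solutions.

  Appending a step to meanders shows that \<open>T\<^sub>j (1 - z P(v))\<close> is \<open>1\<close> up to powers of \<open>v\<close> below \<open>-j\<close>
  (the paths that just left the half plane). Since the \<open>h\<^sub>f\<close> are the coefficients of \<open>1/\<Pi>\<close>, the same holds
  for \<open>S \<Pi>\<close> with \<open>S\<close> the sum of the \<open>h\<^sub>f\<close> for \<open>f \<le> j\<close>. So \<open>\<Pi> (T\<^sub>j U - S)\<close>, and with it \<open>T\<^sub>j U - S\<close>,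
  has only powers below \<open>-j\<close>, whereas \<open>T\<^sub>j\<close>, \<open>U\<close> and \<open>S\<close> exclude these. Hence \<open>T\<^sub>j U = S\<close>.
\<close>

subsection \<open>Power series roots of the kernel\<close>

lemma poly_map_poly_add:
  fixes h :: "'a::comm_ring_1 \<Rightarrow> 'b::comm_ring_1"
  assumes h0: "h 0 = 0" and hadd: "\<And>a b. h (a + b) = h a + h b"
  shows "poly (map_poly h (p + q)) x = poly (map_poly h p) x + poly (map_poly h q) x"
proof -
  have "map_poly h (p + q) = map_poly h p + map_poly h q"
    by (rule poly_eqI) (simp add: coeff_map_poly h0 hadd)
  then show ?thesis by simp
qed

lemma poly_map_poly_mult:
  fixes h :: "'a::comm_ring_1 \<Rightarrow> 'b::comm_ring_1"
  assumes h0: "h 0 = 0" and hadd: "\<And>a b. h (a + b) = h a + h b"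
    and hmult: "\<And>a b. h (a * b) = h a * h b"
  shows "poly (map_poly h (p * q)) x = poly (map_poly h p) x * poly (map_poly h q) x"
proof (induction p)
  case 0
  then show ?case by simp
next
  case (pCons a p)
  have smult: "poly (map_poly h (smult a q)) x = h a * poly (map_poly h q) x"
    by (simp add: map_poly_smult h0 hmult)
  have shift: "poly (map_poly h (pCons 0 (p * q))) x = x * poly (map_poly h (p * q)) x"
    by (simp add: map_poly_pCons h0)
  show ?case
    unfolding mult_pCons_left poly_map_poly_add[of h, OF h0 hadd] smult shift pCons.IH
    by (simp add: map_poly_pCons h0 algebra_simps)
qed

lemma poly_map_poly_sum:
  fixes h :: "'a::comm_ring_1 \<Rightarrow> 'b::comm_ring_1"
  assumes h0: "h 0 = 0" and hadd: "\<And>a b. h (a + b) = h a + h b"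
  shows "poly (map_poly h (\<Sum>i\<in>I. p i)) x = (\<Sum>i\<in>I. poly (map_poly h (p i)) x)"
  by (induction I rule: infinite_finite_induct) (simp_all add: poly_map_poly_add[of h, OF h0 hadd])

lemma poly_map_poly_prod:
  fixes h :: "'a::comm_ring_1 \<Rightarrow> 'b::comm_ring_1"
  assumes h0: "h 0 = 0" and h1: "h 1 = 1" and hadd: "\<And>a b. h (a + b) = h a + h b"
    and hmult: "\<And>a b. h (a * b) = h a * h b"
  shows "poly (map_poly h (\<Prod>i\<in>I. p i)) x = (\<Prod>i\<in>I. poly (map_poly h (p i)) x)"
  by (induction I rule: infinite_finite_induct)
    (simp_all add: poly_map_poly_mult[of h, OF h0 hadd hmult] h1)

text \<open>The factors are split off one at a time: at a new root \<open>a\<close> the factors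
  already removed take the nonzero value \<open>\<Prod>x\<in>S. a - x\<close>, so in an integral
  domain the cofactor must vanish at \<open>a\<close>.\<close>

lemma prod_linear_factors_dvd:
  fixes p :: "'a::idom poly"
  assumes "finite S" "\<And>x. x \<in> S \<Longrightarrow> poly p x = 0"
  shows "(\<Prod>x\<in>S. [:-x, 1:]) dvd p"
  using assms
proof (induction S rule: finite_induct)
  case empty
  then show ?case by simp
next
  case (insert a S)
  then obtain q where q: "p = (\<Prod>x\<in>S. [:-x, 1:]) * q" by (auto elim: dvdE)
  have "(\<Prod>x\<in>S. a - x) \<noteq> 0" using insert.hyps by auto
  moreover have "(\<Prod>x\<in>S. a - x) * poly q a = 0"
    using insert.prems[of a] by (simp add: q poly_prod)
  ultimately have "poly q a = 0" by simp
  then obtain r where "q = [:-a, 1:] * r" by (auto simp: poly_eq_0_iff_dvd elim: dvdE)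
  then have "p = (\<Prod>x\<in>insert a S. [:-x, 1:]) * r"
    using insert.hyps by (simp add: q mult_ac del: mult_pCons_left mult_pCons_right)
  then show ?case by simp
qed

text \<open>
  Taking a \<open>c\<close>-th root of \<open>s ^ c = t ^ c * Q(s)\<close> gives \<open>s = t * R(s)\<close>, so that \<open>s\<close> is the
  compositional inverse of \<open>X / R(X)\<close>. Each choice of \<open>\<alpha> = R(0)\<close> yields one solution.
\<close>

lemma fps_kernel_root_exists:
  fixes Q :: "'a::field_char_0 fps"
  assumes c: "c > 0" and Q0: "fps_nth Q 0 \<noteq> 0" and \<alpha>: "\<alpha> ^ c = fps_nth Q 0"
  shows "\<exists>s. fps_nth s 0 = 0 \<and> fps_nth s 1 = \<alpha> \<and> s ^ c = fps_X ^ c * (Q oo s)"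
proof -
  \<comment> \<open>The root function given to \<open>fps_radical\<close> is constantly
    \<open>\<alpha>\<close>; this selects the branch of the \<open>c\<close>-th root of
    \<open>Q\<close> with constant term \<open>\<alpha>\<close>.\<close>
  define R where "R = fps_radical (\<lambda>_ _. \<alpha>) c Q"
  obtain k where k: "c = Suc k" using c by (cases c) auto
  have R0: "fps_nth R 0 = \<alpha>" using c by (simp add: R_def)
  have \<alpha>0: "\<alpha> \<noteq> 0" using \<alpha> Q0 c by (auto simp: zero_power)
  have Rc: "R ^ c = Q" using power_radical[OF Q0, of "\<lambda>_ _. \<alpha>" k] \<alpha> by (simp add: R_def k)
  define a where "a = fps_X * inverse R"
  define s where "s = fps_inv a"
  have a0: "fps_nth a 0 = 0" by (simp add: a_def)
  have a1: "fps_nth a 1 \<noteq> 0" by (simp add: a_def R0 \<alpha>0)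
  have s0: "fps_nth s 0 = 0" by (simp add: s_def fps_inv_def)
  have "a * R = fps_X * (inverse R * R)" by (simp add: a_def mult.assoc)
  then have "a * R = fps_X" using R0 \<alpha>0 by (simp add: inverse_mult_eq_1)
  then have "(a oo s) * (R oo s) = fps_X oo s" by (simp add: fps_compose_mult_distrib[OF s0, symmetric])
  moreover have "a oo s = fps_X" unfolding s_def by (rule fps_inv_right[OF a0 a1])
  ultimately have s: "s = fps_X * (R oo s)" using s0 by simp
  have "fps_nth s 1 = \<alpha>" by (subst s) (simp add: R0)
  moreover have "s ^ c = fps_X ^ c * (Q oo s)"
    by (subst s) (simp add: power_mult_distrib fps_compose_power[OF s0] Rc)
  ultimately show ?thesis using s0 by blast
qed

text \<open>The polynomial \<open>X\<^sup>c (1 - z P(X))\<close> for \<open>z = t\<^sup>c\<close>.\<close>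

definition kernel_poly :: "int set \<Rightarrow> (int \<Rightarrow> complex) \<Rightarrow> nat \<Rightarrow> complex fps poly" where
  "kernel_poly B w c = monom 1 c - (\<Sum>b\<in>B. monom (fps_const (w b) * fps_X ^ c) (nat (b + int c)))"

text \<open>One formula for all three evaluations of the kernel: \<open>h\<close> is the identity
  for power series roots, \<open>puiseux_of_fps c\<close> for small solutions, and
  \<open>laurent_lift\<close> for the value at \<open>v\<close>.\<close>

lemma poly_map_kernel_poly:
  fixes h :: "complex fps \<Rightarrow> 'b::comm_ring_1"
  assumes h0: "h 0 = 0" and h1: "h 1 = 1" and hadd: "\<And>a b. h (a + b) = h a + h b"
  shows "poly (map_poly h (kernel_poly B w c)) x =
    x ^ c - (\<Sum>b\<in>B. h (fps_const (w b) * fps_X ^ c) * x ^ nat (b + int c))"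
proof -
  have "poly (map_poly h (kernel_poly B w c)) x +
      poly (map_poly h (\<Sum>b\<in>B. monom (fps_const (w b) * fps_X ^ c) (nat (b + int c)))) x = x ^ c"
    unfolding poly_map_poly_add[of h, OF h0 hadd, symmetric] kernel_poly_def
    by (simp add: map_poly_monom h0 h1 poly_monom)
  then show ?thesis
    unfolding poly_map_poly_sum[of h, OF h0 hadd]
    by (simp add: map_poly_monom h0 poly_monom eq_diff_eq)
qed

text \<open>The weight of the lowest step has \<open>c\<close> distinct complex \<open>c\<close>-th
  roots. Each of them is the linear coefficient of one solution, which makes the solutions pairwise
  distinct and nonzero.\<close>

lemma kernel_poly_roots:
  assumes B: "finite B" "B \<noteq> {}" and c: "int c = - Min B" "c \<ge> 1"
    and w: "w (- int c) \<noteq> 0"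
  obtains S where "finite S" "card S = c"
    "\<And>s. s \<in> S \<Longrightarrow> fps_nth s 0 = 0 \<and> s \<noteq> 0 \<and> poly (kernel_poly B w c) s = 0"
proof -
  \<comment> \<open>This is \<open>X ^ c * P(X)\<close>, so the kernel reads
    \<open>X ^ c - t ^ c * Q(X)\<close>; the constant term of \<open>Q\<close> is the weight of the
    step \<open>- int c\<close>.\<close>
  define Q where "Q = (\<Sum>b\<in>B. fps_const (w b) * fps_X ^ nat (b + int c))"
  have mem: "- int c \<in> B" using Min_in[OF B] c by simp
  have ge: "b \<ge> - int c" if "b \<in> B" for b using Min_le[OF B(1) that] c by simp
  have "fps_nth Q 0 = (\<Sum>b\<in>B. if b = - int c then w b else 0)"
    unfolding Q_def fps_sum_nth
  proof (rule sum.cong[OF refl])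
    fix b assume "b \<in> B"
    then have "nat (b + int c) = 0 \<longleftrightarrow> b = - int c" using ge[of b] by auto
    then show "fps_nth (fps_const (w b) * fps_X ^ nat (b + int c)) 0 = (if b = - int c then w b else 0)"
      by (auto simp: fps_X_power_nth)
  qed
  then have Q0: "fps_nth Q 0 = w (- int c)" using mem B(1) by simp
  define A where "A = {\<alpha>. \<alpha> ^ c = w (- int c)}"
  have A: "card A = c" unfolding A_def using w c(2) by (intro card_nth_roots) auto
  have "\<exists>s. fps_nth s 0 = 0 \<and> fps_nth s 1 = \<alpha> \<and> s ^ c = fps_X ^ c * (Q oo s)" if "\<alpha> \<in> A" for \<alpha>
    using that w c(2) by (intro fps_kernel_root_exists) (simp_all add: A_def Q0)
  then obtain sol where sol: "\<And>\<alpha>. \<alpha> \<in> A \<Longrightarrow>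
      fps_nth (sol \<alpha>) 0 = 0 \<and> fps_nth (sol \<alpha>) 1 = \<alpha> \<and> sol \<alpha> ^ c = fps_X ^ c * (Q oo sol \<alpha>)"
    by metis
  have inj: "inj_on sol A" by (metis inj_onI sol)
  show ?thesis
  proof
    show "finite (sol ` A)" using A c(2) by (metis card_ge_0_finite finite_imageI less_le_trans zero_less_one)
    show "card (sol ` A) = c" using A inj by (simp add: card_image)
    fix s assume "s \<in> sol ` A"
    then obtain \<alpha> where \<alpha>: "\<alpha> \<in> A" "s = sol \<alpha>" by auto
    then have s: "fps_nth s 0 = 0" "fps_nth s 1 = \<alpha>" "s ^ c = fps_X ^ c * (Q oo s)" using sol by auto
    have "\<alpha> \<noteq> 0" using \<alpha> w c(2) by (auto simp: A_def zero_power)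
    then have "s \<noteq> 0" using s by auto
    have comp: "Q oo s = (\<Sum>b\<in>B. fps_const (w b) * s ^ nat (b + int c))"
      unfolding Q_def fps_compose_sum_distrib
      by (simp add: fps_compose_mult_distrib[OF s(1)] fps_compose_power[OF s(1), symmetric] s(1))
    have "poly (kernel_poly B w c) s = s ^ c - fps_X ^ c * (Q oo s)"
      using poly_map_kernel_poly[of "\<lambda>x. x" B w c s]
      by (simp add: comp sum_distrib_left mult_ac)
    then show "fps_nth s 0 = 0 \<and> s \<noteq> 0 \<and> poly (kernel_poly B w c) s = 0"
      using s \<open>s \<noteq> 0\<close> by simp
  qed
qed

subsection \<open>Puiseux series and the small solutions\<close>

text \<open>The algebra takes place among power series in \<open>t = z^(1/N)\<close>; for
  \<open>N > 0\<close> this ring embedding carries it over to Puiseux series.\<close>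

definition puiseux_of_fps :: "nat \<Rightarrow> 'a::zero fps \<Rightarrow> 'a puiseux" where
  "puiseux_of_fps N f = puiseux_of_fls N (fps_to_fls f)"

lemma puiseux_of_fps_0 [simp]: "puiseux_of_fps N (0 :: 'a::comm_ring_1 fps) = 0"
  by (simp add: puiseux_of_fps_def puiseux_of_fls_0)

lemma puiseux_of_fps_1 [simp]: "N > 0 \<Longrightarrow> puiseux_of_fps N (1 :: 'a::comm_ring_1 fps) = 1"
  by (simp add: puiseux_of_fps_def puiseux_of_fls_1)

lemma puiseux_of_fps_add:
  "puiseux_of_fps N (f + g) = puiseux_of_fps N f + puiseux_of_fps N (g :: 'a::comm_ring_1 fps)"
  by (simp add: puiseux_of_fps_def puiseux_of_fls_add)

lemma puiseux_of_fps_mult: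
  "N > 0 \<Longrightarrow> puiseux_of_fps N (f * g) = puiseux_of_fps N f * puiseux_of_fps N (g :: 'a::comm_ring_1 fps)"
  by (simp add: puiseux_of_fps_def fls_times_fps_to_fls puiseux_of_fls_mult)

lemma puiseux_of_fps_diff:
  "puiseux_of_fps N (f - g) = puiseux_of_fps N f - puiseux_of_fps N (g :: 'a::comm_ring_1 fps)"
  by (metis add_diff_cancel_right' diff_add_cancel puiseux_of_fps_add)

lemma puiseux_of_fps_power:
  "N > 0 \<Longrightarrow> puiseux_of_fps N (f ^ n) = puiseux_of_fps N (f :: 'a::comm_ring_1 fps) ^ n"
  by (induction n) (simp_all add: puiseux_of_fps_mult)

lemma puiseux_of_fps_sum:
  "puiseux_of_fps N (\<Sum>i\<in>I. f i) = (\<Sum>i\<in>I. puiseux_of_fps N (f i :: 'a::comm_ring_1 fps))"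
  by (induction I rule: infinite_finite_induct) (simp_all add: puiseux_of_fps_add)

lemma puiseux_of_fps_prod:
  "N > 0 \<Longrightarrow> puiseux_of_fps N (\<Prod>i\<in>I. f i) = (\<Prod>i\<in>I. puiseux_of_fps N (f i :: 'a::comm_ring_1 fps))"
  by (induction I rule: infinite_finite_induct) (simp_all add: puiseux_of_fps_mult)

lemma puiseux_nth_of_fps:
  assumes "N > 0"
  shows "puiseux_nth (puiseux_of_fps N f) (of_nat n / of_nat N) = fps_nth f n"
  using fls_spread_of_int[OF assms, of "fps_to_fls f" "int n"]
  by (simp add: puiseux_of_fps_def puiseux_of_fls.rep_eq)

lemma puiseux_nth_of_fps_nonzeroE:
  assumes "puiseux_nth (puiseux_of_fps N f) q \<noteq> 0"
  obtains n where "q = of_nat n / of_nat N" "fps_nth f n \<noteq> 0" "N > 0"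
proof -
  from assms obtain k where k: "q = of_int k / of_nat N" "fls_nth (fps_to_fls f) k \<noteq> 0" "N > 0"
    by (auto simp: puiseux_of_fps_def puiseux_of_fls.rep_eq elim: fls_spread_nonzeroE)
  then have "k \<ge> 0" by (auto simp: not_less[symmetric])
  with k that[of "nat k"] show ?thesis by auto
qed

lemma inj_puiseux_of_fps: "N > 0 \<Longrightarrow> inj (puiseux_of_fps N)"
  by (rule injI, rule fps_ext) (metis puiseux_nth_of_fps)

text \<open>For \<open>N > 0\<close> this is the substitution \<open>f(t ^ N)\<close>, which turns a
  series in \<open>z\<close> into one in \<open>t = z^(1/N)\<close>.\<close>

definition fps_dilate :: "nat \<Rightarrow> 'a::zero fps \<Rightarrow> 'a fps" where
  "fps_dilate N f = Abs_fps (\<lambda>n. if N dvd n then fps_nth f (n div N) else 0)"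

lemma puiseux_of_fls_1_fps:
  assumes N: "N > 0"
  shows "puiseux_of_fls 1 (fps_to_fls f) = puiseux_of_fps N (fps_dilate N f)"
proof -
  have "fls_spread 1 (fps_to_fls f) = fls_spread N (fps_to_fls (fps_dilate N f))"
  proof (rule fls_spread_eqI[OF N])
    fix q assume "fls_spread 1 (fps_to_fls f) q \<noteq> 0"
    then obtain k where "q = of_int k / of_nat 1" by (rule fls_spread_nonzeroE)
    then have "q = of_int (k * int N) / of_nat N" using N by simp
    then show "\<exists>k. q = of_int k / of_nat N" by blast
  next
    fix k :: int
    show "fls_nth (fps_to_fls (fps_dilate N f)) k = fls_spread 1 (fps_to_fls f) (of_int k / of_nat N)"
    proof (cases "int N dvd k")
      case True
      then obtain l where k: "k = int N * l" by (auto elim: dvdE)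
      have "nat (int N * l) div N = nat l" if "l \<ge> 0"
        using that N by (simp add: nat_mult_distrib)
      moreover have "N dvd nat (int N * l)" if "l \<ge> 0"
        using that by (simp add: nat_mult_distrib)
      ultimately show ?thesis
        using N fls_spread_of_int[of 1 "fps_to_fls f" l]
        by (auto simp: k fps_dilate_def mult_less_0_iff)
    next
      case False
      have "of_int k / (of_nat N :: rat) \<notin> \<int>"
      proof
        assume "of_int k / (of_nat N :: rat) \<in> \<int>"
        then obtain l where "of_int k / (of_nat N :: rat) = of_int l" by (auto elim: Ints_cases)
        then have "(of_int k :: rat) = of_int (int N * l)" using N by (simp add: field_simps)
        then have "k = int N * l" by (simp only: of_int_eq_iff)
        then show False using False by simp
      qed
      moreover have "\<not> N dvd nat k" if "k \<ge> 0"
        using that False by (metis int_dvd_int_iff int_nat_eq)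
      ultimately show ?thesis by (auto simp: fls_spread_def fps_dilate_def)
    qed
  qed
  then show ?thesis
    by (simp add: puiseux_nth_inject[symmetric] puiseux_of_fps_def puiseux_of_fls.rep_eq)
qed

lemma puiseux_const_eq: "N > 0 \<Longrightarrow> puiseux_const a = puiseux_of_fps N (fps_const a)"
  unfolding puiseux_const_def fps_const_to_fls[symmetric]
  by (subst puiseux_of_fls_1_fps[of N])
    (auto intro!: arg_cong[of _ _ "puiseux_of_fps N"] fps_ext simp: fps_dilate_def elim!: dvdE)

lemma puiseux_Z_eq: "N > 0 \<Longrightarrow> puiseux_Z = puiseux_of_fps N (fps_X ^ N :: 'a::comm_ring_1 fps)"
  unfolding puiseux_Z_def fps_X_to_fls[symmetric]
  by (subst puiseux_of_fls_1_fps[of N])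
    (auto intro!: arg_cong[of _ _ "puiseux_of_fps N"] fps_ext
      simp: fps_dilate_def fps_X_power_nth elim!: dvdE)

section \<open>Orders of Puiseux series\<close>

definition puiseux_nonneg_order :: "'a::zero puiseux \<Rightarrow> bool" where
  "puiseux_nonneg_order x \<longleftrightarrow> (\<forall>q. puiseux_nth x q \<noteq> 0 \<longrightarrow> q \<ge> 0)"

lemma puiseux_nth_add: "puiseux_nth (x + y) q = puiseux_nth x q + puiseux_nth (y::'a::comm_ring_1 puiseux) q"
  by (simp add: plus_puiseux.rep_eq)

lemma puiseux_nonneg_order_add:
  fixes x y :: "'a::comm_ring_1 puiseux"
  shows "puiseux_nonneg_order x \<Longrightarrow> puiseux_nonneg_order y \<Longrightarrow> puiseux_nonneg_order (x + y)"
  unfolding puiseux_nonneg_order_def puiseux_nth_add by (metis add_0)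

lemma puiseux_nonneg_order_of_fps: "puiseux_nonneg_order (puiseux_of_fps N f)"
  unfolding puiseux_nonneg_order_def
  by (auto elim!: puiseux_nth_of_fps_nonzeroE)

lemma puiseux_nth_mult_nonzeroE:
  fixes x y :: "'a::comm_ring_1 puiseux"
  assumes "puiseux_nth (x * y) q \<noteq> 0"
  obtains p where "puiseux_nth x p \<noteq> 0" "puiseux_nth y (q - p) \<noteq> 0"
proof -
  from assms have "(\<Sum>p | puiseux_nth x p \<noteq> 0 \<and> puiseux_nth y (q - p) \<noteq> 0.
      puiseux_nth x p * puiseux_nth y (q - p)) \<noteq> 0"
    by (simp add: times_puiseux.rep_eq puiseux_conv_def)
  then show ?thesis using that by (elim sum.not_neutral_contains_not_neutral) auto
qed

lemma puiseux_pos_order_mult: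
  fixes x y :: "'a::comm_ring_1 puiseux"
  assumes "puiseux_pos_order x" "puiseux_nonneg_order y"
  shows "puiseux_pos_order (x * y)"
  unfolding puiseux_pos_order_def
proof (intro allI impI)
  fix q assume "puiseux_nth (x * y) q \<noteq> 0"
  then obtain p where "puiseux_nth x p \<noteq> 0" "puiseux_nth y (q - p) \<noteq> 0"
    by (rule puiseux_nth_mult_nonzeroE)
  then have "p > 0" "q - p \<ge> 0" using assms by (auto simp: puiseux_pos_order_def puiseux_nonneg_order_def)
  then show "q > 0" by simp
qed

lemma puiseux_nonneg_order_poly:
  fixes x :: "'a::comm_ring_1 puiseux"
  assumes "puiseux_pos_order x"
  shows "puiseux_nonneg_order (poly (map_poly (puiseux_of_fps N) p) x)"
proof (induction p)
  case 0
  then show ?case by (simp add: puiseux_nonneg_order_def zero_puiseux.rep_eq)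
next
  case (pCons a p)
  have "puiseux_nonneg_order (x * poly (map_poly (puiseux_of_fps N) p) x)"
    using puiseux_pos_order_mult[OF assms pCons.IH]
    by (auto simp: puiseux_pos_order_def puiseux_nonneg_order_def intro: less_imp_le)
  then show ?case
    by (simp add: map_poly_pCons puiseux_nonneg_order_add puiseux_nonneg_order_of_fps)
qed

text \<open>All terms except the constant coefficient of \<open>p\<close> carry a factor
  \<open>x\<close> of positive order, so the coefficient at exponent 0 comes from
  \<open>coeff p 0\<close> alone. This shows that the cofactor of the linear factors has no small
  root.\<close>

lemma poly_puiseux_nonzero:
  fixes x :: "'a::comm_ring_1 puiseux"
  assumes N: "N > 0" and x: "puiseux_pos_order x" and p: "fps_nth (coeff p 0) 0 \<noteq> 0"
  shows "poly (map_poly (puiseux_of_fps N) p) x \<noteq> 0"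
proof -
  obtain a r where ar: "p = pCons a r" by (metis pCons_cases)
  have "puiseux_pos_order (x * poly (map_poly (puiseux_of_fps N) r) x)"
    by (intro puiseux_pos_order_mult x puiseux_nonneg_order_poly)
  then have "puiseux_nth (x * poly (map_poly (puiseux_of_fps N) r) x) 0 = 0"
    by (auto simp: puiseux_pos_order_def)
  moreover have "puiseux_nth (puiseux_of_fps N a) 0 \<noteq> 0"
    using puiseux_nth_of_fps[OF N, of a 0] p by (simp add: ar)
  ultimately have "puiseux_nth (poly (map_poly (puiseux_of_fps N) p) x) 0 \<noteq> 0"
    by (simp add: ar map_poly_pCons puiseux_nth_add)
  then show ?thesis by (auto simp: zero_puiseux.rep_eq)
qed

lemma puiseux_pos_order_of_fps:
  assumes "fps_nth f 0 = 0"
  shows "puiseux_pos_order (puiseux_of_fps N f)"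
  unfolding puiseux_pos_order_def
proof (intro allI impI)
  fix q assume "puiseux_nth (puiseux_of_fps N f) q \<noteq> 0"
  then obtain n where n: "q = of_nat n / of_nat N" "fps_nth f n \<noteq> 0" "N > 0"
    by (rule puiseux_nth_of_fps_nonzeroE)
  then have "n > 0" using assms by (cases n) auto
  with n show "q > 0" by simp
qed

section \<open>Small solutions as roots of the kernel polynomial\<close>

text \<open>No step goes below \<open>- int c\<close>, so multiplying by the nonzero element
  \<open>X ^ c\<close> of the field of complex Puiseux series clears all negative powers.\<close>

lemma kernel_eq_iff:
  fixes X :: "complex puiseux"
  assumes B: "\<And>b. b \<in> B \<Longrightarrow> b \<ge> - int c" and c: "c \<ge> 1" and X: "X \<noteq> 0"
  shows "1 - puiseux_Z * step_char_poly B (\<lambda>b. real_const (w b)) X = 0 \<longleftrightarrow>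
    poly (map_poly (puiseux_of_fps c) (kernel_poly B (\<lambda>b. complex_of_real (w b)) c)) X = 0"
proof -
  have c0: "c > 0" using c by simp
  have pw: "X ^ c * X powi b = X ^ nat (b + int c)" if "b \<in> B" for b
  proof -
    have "X ^ c * X powi b = X powi (int c + b)" using X by (simp add: power_int_add)
    also have "\<dots> = X ^ nat (b + int c)" using B[OF that] by (simp add: power_int_def add.commute)
    finally show ?thesis .
  qed
  have "poly (map_poly (puiseux_of_fps c) (kernel_poly B (\<lambda>b. complex_of_real (w b)) c)) X
      = X ^ c - (\<Sum>b\<in>B. real_const (w b) * puiseux_Z * X ^ nat (b + int c))"
    by (subst poly_map_kernel_poly)
      (simp_all add: c0 puiseux_of_fps_add puiseux_of_fps_mult real_const_def
        puiseux_const_eq[OF c0] puiseux_Z_eq[OF c0])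
  also have "\<dots> = X ^ c - (\<Sum>b\<in>B. real_const (w b) * puiseux_Z * (X ^ c * X powi b))"
    by (simp add: pw)
  also have "\<dots> = X ^ c * (1 - puiseux_Z * step_char_poly B (\<lambda>b. real_const (w b)) X)"
    unfolding step_char_poly_def by (simp add: sum_distrib_left right_diff_distrib mult_ac)
  finally show ?thesis using X by simp
qed

text \<open>The \<open>c\<close> power series roots are small solutions. There are no others,
  because the cofactor \<open>U\<close> cannot vanish at a series of positive order.\<close>

lemma small_solutions_factorization:
  assumes B: "finite B" "B \<noteq> {}" and w: "\<And>b. b \<in> B \<Longrightarrow> w b > 0"
    and c: "int c = - Min B" "c \<ge> 1"
  obtains S U where "finite S" "card S = c" "\<And>s. s \<in> S \<Longrightarrow> fps_nth s 0 = 0"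
    "kernel_poly B (\<lambda>b. complex_of_real (w b)) c = (\<Prod>s\<in>S. [:-s, 1:]) * U"
    "small_solutions B w = puiseux_of_fps c ` S"
proof -
  let ?p = "kernel_poly B (\<lambda>b. complex_of_real (w b)) c"
  let ?h = "puiseux_of_fps c :: complex fps \<Rightarrow> _"
  have c0: "c > 0" using c by simp
  have mem: "- int c \<in> B" using Min_in[OF B] c by simp
  have ge: "b \<ge> - int c" if "b \<in> B" for b using Min_le[OF B(1) that] c by simp
  have w0: "complex_of_real (w (- int c)) \<noteq> 0" using w[OF mem] by simp
  obtain S where S: "finite S" "card S = c"
    "\<And>s. s \<in> S \<Longrightarrow> fps_nth s 0 = 0 \<and> s \<noteq> 0 \<and> poly ?p s = 0"
    by (rule kernel_poly_roots[where w = "\<lambda>b. complex_of_real (w b)", OF B c w0]) blast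
  then have "(\<Prod>s\<in>S. [:-s, 1:]) dvd ?p" by (intro prod_linear_factors_dvd) auto
  then obtain U where U: "?p = (\<Prod>s\<in>S. [:-s, 1:]) * U" by (auto elim: dvdE)
  have ev_lin: "poly (map_poly ?h [:-s, 1:]) X = X - ?h s" for s X
    using puiseux_of_fps_diff[of c 0 s] by (simp add: map_poly_pCons c0)
  have ev: "poly (map_poly ?h ?p) X = (\<Prod>s\<in>S. X - ?h s) * poly (map_poly ?h U) X" for X
    unfolding U
    by (subst poly_map_poly_mult, simp_all add: c0 puiseux_of_fps_add puiseux_of_fps_mult)
      (subst poly_map_poly_prod, simp_all add: c0 puiseux_of_fps_add puiseux_of_fps_mult ev_lin del: map_poly_pCons)
  \<comment> \<open>Evaluate the factorization at 0. The kernel gives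
    \<open>- w (- int c) * t ^ c\<close>, and each of the \<open>c\<close> roots is divisible by
    \<open>t\<close>; cancelling \<open>t ^ c\<close> expresses a nonzero constant as a multiple of
    \<open>coeff U 0\<close>.\<close>
  have U0: "fps_nth (coeff U 0) 0 \<noteq> 0"
  proof
    assume *: "fps_nth (coeff U 0) 0 = 0"
    have "poly ?p 0 = 0 ^ c - (\<Sum>b\<in>B. fps_const (complex_of_real (w b)) * fps_X ^ c * 0 ^ nat (b + int c))"
      using poly_map_kernel_poly[of "\<lambda>x. x" B _ c 0] by simp
    also have "(\<Sum>b\<in>B. fps_const (complex_of_real (w b)) * fps_X ^ c * 0 ^ nat (b + int c)) =
        (\<Sum>b\<in>B. if b = - int c then fps_const (complex_of_real (w b)) * fps_X ^ c else 0)"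
    proof (rule sum.cong[OF refl])
      fix b assume "b \<in> B"
      then have "nat (b + int c) = 0 \<longleftrightarrow> b = - int c" using ge[of b] by auto
      then show "fps_const (complex_of_real (w b)) * fps_X ^ c * 0 ^ nat (b + int c) =
          (if b = - int c then fps_const (complex_of_real (w b)) * fps_X ^ c else 0)"
        by (auto simp: zero_power)
    qed
    finally have "poly ?p 0 = fps_X ^ c * - fps_const (complex_of_real (w (- int c)))"
      using mem B(1) c0 by (simp add: zero_power)
    moreover have "poly ?p 0 = (\<Prod>s\<in>S. - s) * coeff U 0"
      unfolding U poly_0_coeff_0[symmetric] by (simp add: poly_prod)
    \<comment> \<open>Since \<open>s\<close> has no constant term, \<open>fps_shift 1 s\<close> is
      the quotient \<open>s / t\<close>.\<close>
    moreover have "(\<Prod>s\<in>S. - s) = fps_X ^ c * (\<Prod>s\<in>S. - fps_shift 1 s)"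
    proof -
      have "- s = fps_X * - fps_shift 1 s" if "s \<in> S" for s
        using S(3)[OF that] by (intro fps_ext) (simp add: fps_X_mult_nth)
      then have "(\<Prod>s\<in>S. - s) = (\<Prod>s\<in>S. fps_X * - fps_shift 1 s)" by (rule prod.cong[OF refl])
      then show ?thesis by (simp only: prod.distrib prod_constant S(2))
    qed
    ultimately have "- fps_const (complex_of_real (w (- int c))) = (\<Prod>s\<in>S. - fps_shift 1 s) * coeff U 0"
      by (simp add: mult.assoc)
    then have "fps_nth (- fps_const (complex_of_real (w (- int c)))) 0 = 0" using * by simp
    then show False using w0 by simp
  qed
  have "small_solutions B w = ?h ` S"
  proof (intro set_eqI iffI)
    fix X assume "X \<in> small_solutions B w"
    then have X: "X \<noteq> 0" "puiseux_pos_order X" "poly (map_poly ?h ?p) X = 0"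
      using kernel_eq_iff[OF ge c(2), of B X w] by (auto simp: small_solutions_def)
    then have "(\<Prod>s\<in>S. X - ?h s) = 0"
      using poly_puiseux_nonzero[OF c0 X(2) U0] by (simp add: ev)
    then show "X \<in> ?h ` S" using S(1) by auto
  next
    fix X assume "X \<in> ?h ` S"
    then obtain s where s: "s \<in> S" "X = ?h s" by auto
    then have "X \<noteq> 0" using S(3) inj_puiseux_of_fps[OF c0] by (metis injD puiseux_of_fps_0)
    moreover have "poly (map_poly ?h ?p) X = 0" unfolding ev using s S(1) by auto
    ultimately show "X \<in> small_solutions B w"
      using kernel_eq_iff[OF ge c(2), of B X w] s S(3)
      by (auto simp: small_solutions_def puiseux_pos_order_of_fps)
  qed
  with that S U show ?thesis by blast
qed

subsection \<open>Complete homogeneous polynomials and supports in \<open>v\<close>\<close>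

lemma complete_homogeneous_0 [simp]: "complete_homogeneous c 0 x = 1"
proof -
  have "{is. length is = 0 \<and> sorted is \<and> set is \<subseteq> {1..c}} = {[]}" by auto
  then show ?thesis by (simp add: complete_homogeneous_def)
qed

lemma complete_homogeneous_no_variables: "complete_homogeneous 0 (Suc f) x = 0"
proof -
  have "{is :: nat list. length is = Suc f \<and> sorted is \<and> set is \<subseteq> {1..0}} = {}" by auto
  then show ?thesis unfolding complete_homogeneous_def by (metis sum.empty)
qed

text \<open>A sorted index list either avoids the largest index \<open>Suc c\<close> or ends in it;
  in the second case deleting the last entry leaves an arbitrary sorted list of length
  \<open>f\<close> over the same indices.\<close>

lemma complete_homogeneous_Suc:
  "complete_homogeneous (Suc c) (Suc f) x =
    complete_homogeneous c (Suc f) x + x (Suc c) * complete_homogeneous (Suc c) f x"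
proof -
  define I where "I c f = {is :: nat list. length is = f \<and> sorted is \<and> set is \<subseteq> {1..c}}" for c f
  have fin: "finite (I c f)" for c f
    by (rule finite_subset[OF _ finite_lists_length_eq[of "{1..c}" f]]) (auto simp: I_def)
  have eq: "I (Suc c) (Suc f) = I c (Suc f) \<union> (\<lambda>is. is @ [Suc c]) ` I (Suc c) f"
  proof (intro set_eqI iffI)
    fix js assume js: "js \<in> I (Suc c) (Suc f)"
    then obtain as a where as: "js = as @ [a]"
      by (cases js rule: rev_cases) (auto simp: I_def)
    show "js \<in> I c (Suc f) \<union> (\<lambda>is. is @ [Suc c]) ` I (Suc c) f"
    proof (cases "a = Suc c")
      case True
      then show ?thesis using js by (auto simp: I_def as sorted_append)
    next
      case False
      then have "a \<le> c" using js by (auto simp: I_def as)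
      then show ?thesis using js by (fastforce simp: I_def as sorted_append)
    qed
  next
    fix js assume "js \<in> I c (Suc f) \<union> (\<lambda>is. is @ [Suc c]) ` I (Suc c) f"
    then show "js \<in> I (Suc c) (Suc f)" by (fastforce simp: I_def sorted_append)
  qed
  have disj: "I c (Suc f) \<inter> (\<lambda>is. is @ [Suc c]) ` I (Suc c) f = {}"
    by (auto simp: I_def)
  have "complete_homogeneous (Suc c) (Suc f) x =
      (\<Sum>is\<in>I c (Suc f). prod_list (map x is)) +
      (\<Sum>is\<in>(\<lambda>is. is @ [Suc c]) ` I (Suc c) f. prod_list (map x is))"
    unfolding complete_homogeneous_def I_def[symmetric] eq
    by (rule sum.union_disjoint[OF fin finite_imageI[OF fin] disj])
  also have "(\<Sum>is\<in>(\<lambda>is. is @ [Suc c]) ` I (Suc c) f. prod_list (map x is)) =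
      (\<Sum>is\<in>I (Suc c) f. x (Suc c) * prod_list (map x is))"
    by (subst sum.reindex) (auto simp: inj_on_def mult.commute)
  finally show ?thesis
    by (simp add: complete_homogeneous_def I_def sum_distrib_left)
qed

text \<open>Multiplying the sum of all complete homogeneous polynomials by
  \<open>1 - x (Suc c)\<close> eliminates that variable. For the sum truncated at \<open>j\<close>,
  the recurrence telescopes up to one boundary term of degree \<open>j + 1\<close>.\<close>

lemma sum_complete_homogeneous_Suc:
  "(1 - x (Suc c)) * (\<Sum>f=0..j. complete_homogeneous (Suc c) f x) =
    (\<Sum>f=0..j. complete_homogeneous c f x) - x (Suc c) * complete_homogeneous (Suc c) j x"
proof (induction j)
  case 0
  then show ?case by simp
next
  case (Suc j)
  have "(1 - x (Suc c)) * (\<Sum>f=0..Suc j. complete_homogeneous (Suc c) f x) =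
      (1 - x (Suc c)) * (\<Sum>f=0..j. complete_homogeneous (Suc c) f x) +
      (1 - x (Suc c)) * complete_homogeneous (Suc c) (Suc j) x"
    by (simp add: algebra_simps)
  also have "\<dots> = (\<Sum>f=0..Suc j. complete_homogeneous c f x) -
      x (Suc c) * complete_homogeneous (Suc c) (Suc j) x"
    unfolding Suc.IH by (simp add: complete_homogeneous_Suc algebra_simps)
  finally show ?case .
qed

lemma puiseux_of_fps_complete_homogeneous:
  assumes "N > 0"
  shows "puiseux_of_fps N (complete_homogeneous c f x) = complete_homogeneous c f (\<lambda>l. puiseux_of_fps N (x l))"
proof -
  have "puiseux_of_fps N (prod_list (map x is)) = prod_list (map (\<lambda>l. puiseux_of_fps N (x l)) is)" for "is"
    by (induction "is") (simp_all add: assms puiseux_of_fps_mult)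
  then show ?thesis by (simp add: complete_homogeneous_def puiseux_of_fps_sum)
qed

section \<open>Exponents of \<open>v\<close> occurring in a power series\<close>

text \<open>Exponents of \<open>v\<close> are levels relative to the start \<open>j\<close>:
  \<open>{- int j..}\<close> stands for the permitted half plane and \<open>{..<- int j}\<close> for
  the levels below it.\<close>

definition levels_in :: "int set \<Rightarrow> 'a::zero laurent_poly fps \<Rightarrow> bool" where
  "levels_in K f \<longleftrightarrow> (\<forall>n. Poly_Mapping.keys (fps_nth f n) \<subseteq> K)"

lemma levels_in_mono: "levels_in K f \<Longrightarrow> K \<subseteq> L \<Longrightarrow> levels_in L f"
  by (auto simp: levels_in_def)

lemma levels_in_0 [simp]: "levels_in K 0"
  by (simp add: levels_in_def)

lemma levels_in_const: "Poly_Mapping.keys a \<subseteq> K \<Longrightarrow> levels_in K (fps_const a)"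
  by (simp add: levels_in_def)

lemma levels_in_1: "0 \<in> K \<Longrightarrow> levels_in K (1 :: 'a::comm_ring_1 laurent_poly fps)"
  using levels_in_const[of "1 :: 'a laurent_poly" K] by simp

lemma levels_in_add:
  fixes f g :: "'a::comm_ring_1 laurent_poly fps"
  shows "levels_in K f \<Longrightarrow> levels_in K g \<Longrightarrow> levels_in K (f + g)"
  unfolding levels_in_def fps_add_nth using Poly_Mapping.keys_add by fast

lemma levels_in_diff:
  fixes f g :: "'a::comm_ring_1 laurent_poly fps"
  assumes "levels_in K f" "levels_in K g"
  shows "levels_in K (f - g)"
proof -
  have "levels_in K (- g)" using assms(2) by (auto simp: levels_in_def in_keys_iff)
  with assms(1) have "levels_in K (f + - g)" by (rule levels_in_add)
  then show ?thesis by simp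
qed

lemma levels_in_sum:
  fixes f :: "'i \<Rightarrow> 'a::comm_ring_1 laurent_poly fps"
  shows "(\<And>i. i \<in> I \<Longrightarrow> levels_in K (f i)) \<Longrightarrow> levels_in K (\<Sum>i\<in>I. f i)"
  by (induction I rule: infinite_finite_induct) (auto intro: levels_in_add)

lemma keys_mult_subset:
  fixes a b :: "'a::comm_ring_1 laurent_poly"
  assumes "Poly_Mapping.keys a \<subseteq> K" "Poly_Mapping.keys b \<subseteq> L"
    and "\<And>k l. k \<in> K \<Longrightarrow> l \<in> L \<Longrightarrow> k + l \<in> M"
  shows "Poly_Mapping.keys (a * b) \<subseteq> M"
  using keys_mult[of a b] assms by blast

lemma levels_in_mult:
  fixes f g :: "'a::comm_ring_1 laurent_poly fps"
  assumes "levels_in K f" "levels_in L g" "\<And>k l. k \<in> K \<Longrightarrow> l \<in> L \<Longrightarrow> k + l \<in> M"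
  shows "levels_in M (f * g)"
  unfolding levels_in_def
proof
  fix n
  have "Poly_Mapping.keys (fps_nth (f * g) n) \<subseteq>
      (\<Union>i\<in>{0..n}. Poly_Mapping.keys (fps_nth f i * fps_nth g (n - i)))"
    unfolding fps_mult_nth by (rule keys_sum)
  also have "\<dots> \<subseteq> M"
    using assms by (intro UN_least keys_mult_subset[of _ K _ L]) (auto simp: levels_in_def)
  finally show "Poly_Mapping.keys (fps_nth (f * g) n) \<subseteq> M" .
qed

lemma levels_in_complete_homogeneous:
  fixes x :: "nat \<Rightarrow> 'a::comm_ring_1 laurent_poly fps"
  assumes "\<And>l. l \<in> {1..c} \<Longrightarrow> levels_in {-1} (x l)"
  shows "levels_in {- int f} (complete_homogeneous c f x)"
proof -
  have "levels_in {- int (length is)} (prod_list (map x is))" if "set is \<subseteq> {1..c}" for "is"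
    using that
  proof (induction "is")
    case Nil
    then show ?case by (simp add: levels_in_1)
  next
    case (Cons a "is")
    then have "levels_in {-1} (x a)" "levels_in {- int (length is)} (prod_list (map x is))"
      using assms by auto
    then show ?case by (auto intro: levels_in_mult)
  qed
  then show ?thesis unfolding complete_homogeneous_def by (intro levels_in_sum) auto
qed

lemma levels_in_prod_one_minus:
  fixes x :: "'i \<Rightarrow> 'a::comm_ring_1 laurent_poly fps"
  assumes "\<And>l. l \<in> I \<Longrightarrow> levels_in {-1} (x l)"
  shows "levels_in {..0} (\<Prod>l\<in>I. 1 - x l)"
  using assms
proof (induction I rule: infinite_finite_induct)
  case (insert a I)
  have "levels_in {..0} (1 - x a)"
    using insert.prems levels_in_mono[of "{-1}" "x a" "{..0}"]
    by (intro levels_in_diff levels_in_1) auto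
  then have "levels_in {..0} ((1 - x a) * (\<Prod>l\<in>I. 1 - x l))"
    using insert.IH insert.prems by (intro levels_in_mult) auto
  then show ?case using insert.hyps by simp
qed (simp_all add: levels_in_1)

text \<open>Formally the sum of all complete homogeneous polynomials inverts the product. Truncation
  at \<open>j\<close> leaves an error of terms of degree above \<open>j\<close>, and each variable
  contributes the exponent -1 of \<open>v\<close>. The induction adds one variable at a
  time.\<close>

lemma levels_in_sum_complete_homogeneous:
  fixes x :: "nat \<Rightarrow> 'a::comm_ring_1 laurent_poly fps"
  assumes "\<And>l. l \<in> {1..c} \<Longrightarrow> levels_in {-1} (x l)"
  shows "levels_in {..<- int j}
    ((\<Sum>f=0..j. complete_homogeneous c f x) * (\<Prod>l=1..c. 1 - x l) - 1)"
  using assms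
proof (induction c)
  case 0
  have "(\<Sum>f=0..j. complete_homogeneous 0 f x) = 1"
    by (induction j) (simp_all add: complete_homogeneous_no_variables)
  then show ?case by simp
next
  case (Suc c)
  let ?S = "\<lambda>c. \<Sum>f=0..j. complete_homogeneous c f x" and ?P = "\<lambda>c. \<Prod>l=1..c. 1 - x l"
  have "?S (Suc c) * ?P (Suc c) - 1 = ((1 - x (Suc c)) * ?S (Suc c)) * ?P c - 1"
    by (simp add: mult_ac)
  also have "\<dots> = (?S c * ?P c - 1) - x (Suc c) * complete_homogeneous (Suc c) j x * ?P c"
    unfolding sum_complete_homogeneous_Suc by (simp add: algebra_simps)
  finally have eq: "?S (Suc c) * ?P (Suc c) - 1 = \<dots>" .
  \<comment> \<open>The boundary term is homogeneous of degree \<open>j + 1\<close>, hence has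
    exponent \<open>- int j - 1\<close>; the remaining product never raises exponents.\<close>
  have "levels_in {..<- int j} (x (Suc c) * complete_homogeneous (Suc c) j x)"
    using Suc.prems by (intro levels_in_mult[OF _ levels_in_complete_homogeneous, of "{-1}"]) auto
  then have "levels_in {..<- int j} (x (Suc c) * complete_homogeneous (Suc c) j x * ?P c)"
    using Suc.prems by (intro levels_in_mult[OF _ levels_in_prod_one_minus, of "{..<- int j}"]) auto
  then show ?case unfolding eq using Suc by (intro levels_in_diff[of _ "_ - _"]) auto
qed

text \<open>As \<open>f\<close> has constant term 1, the coefficients of \<open>g\<close> are
  determined recursively: each is a coefficient of \<open>f * g\<close> minus products of earlier
  coefficients of \<open>g\<close> with coefficients of \<open>f\<close>, and the latter never raise
  exponents of \<open>v\<close>.\<close>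

lemma levels_in_cancel_unipotent:
  fixes f g :: "'a::comm_ring_1 laurent_poly fps"
  assumes fg: "levels_in {..<k} (f * g)" and f: "levels_in {..0} f" and f0: "fps_nth f 0 = 1"
  shows "levels_in {..<k} g"
  unfolding levels_in_def
proof
  fix n
  show "Poly_Mapping.keys (fps_nth g n) \<subseteq> {..<k}"
  proof (induction n rule: less_induct)
    case (less n)
    define r where "r = (\<Sum>i=1..n. fps_nth f i * fps_nth g (n - i))"
    have "fps_nth (f * g) n = fps_nth g n + r"
      unfolding fps_mult_nth r_def by (subst sum.atLeast_Suc_atMost) (simp_all add: f0)
    then have eq: "fps_nth g n = fps_nth (f * g) n - r" by simp
    have "Poly_Mapping.keys r \<subseteq> (\<Union>i\<in>{1..n}. Poly_Mapping.keys (fps_nth f i * fps_nth g (n - i)))"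
      unfolding r_def by (rule keys_sum)
    also have "\<dots> \<subseteq> {..<k}"
      using f less.IH by (intro UN_least keys_mult_subset[of _ "{..0}" _ "{..<k}"]) (auto simp: levels_in_def)
    finally have "Poly_Mapping.keys r \<subseteq> {..<k}" .
    moreover have "Poly_Mapping.keys (fps_nth (f * g) n) \<subseteq> {..<k}" using fg by (simp add: levels_in_def)
    ultimately show ?case
      unfolding eq using Poly_Mapping.keys_diff by fast
  qed
qed

lemma levels_in_disjoint:
  fixes f :: "'a::comm_ring_1 laurent_poly fps"
  assumes "levels_in K f" "levels_in L f" "K \<inter> L = {}"
  shows "f = 0"
proof (rule fps_ext)
  fix n
  have "Poly_Mapping.keys (fps_nth f n) = {}"
    using assms unfolding levels_in_def by blast
  then show "fps_nth f n = fps_nth 0 n" by simp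
qed

subsection \<open>Meanders\<close>

definition meanders :: "int set \<Rightarrow> nat \<Rightarrow> nat \<Rightarrow> (int \<times> int) list set" where
  "meanders B j n = {p. is_meander ({1} \<times> B) j p \<and> path_length p = n}"

lemma is_meander_snoc:
  assumes "p \<noteq> []"
  shows "is_meander S j (p @ [q]) \<longleftrightarrow> is_meander S j p \<and> q - last p \<in> S \<and> snd q \<ge> 0"
proof -
  have "(\<forall>i. Suc i < length (p @ [q]) \<longrightarrow> (p @ [q]) ! Suc i - (p @ [q]) ! i \<in> S) \<longleftrightarrow>
      (\<forall>i. Suc i < length p \<longrightarrow> p ! Suc i - p ! i \<in> S) \<and> q - last p \<in> S" (is "?L \<longleftrightarrow> ?R")
  proof
    assume L: ?L
    have "p ! Suc i - p ! i \<in> S" if "Suc i < length p" for i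
      using L[rule_format, of i] that by (simp add: nth_append)
    moreover have "q - last p \<in> S"
      using L[rule_format, of "length p - 1"] assms by (simp add: nth_append last_conv_nth)
    ultimately show ?R by blast
  next
    assume R: ?R
    show ?L
    proof (intro allI impI)
      fix i assume i: "Suc i < length (p @ [q])"
      show "(p @ [q]) ! Suc i - (p @ [q]) ! i \<in> S"
      proof (cases "Suc i < length p")
        case True
        then show ?thesis using R by (simp add: nth_append)
      next
        case False
        with i have "i = length p - 1" by simp
        then show ?thesis using R assms by (simp add: nth_append last_conv_nth)
      qed
    qed
  qed
  then show ?thesis using assms by (auto simp: is_meander_def)
qed

lemma path_weight_snoc:
  assumes "p \<noteq> []"
  shows "path_weight w (p @ [q]) = path_weight w p * w (snd (q - last p))"
proof -
  obtain n where n: "length p = Suc n" using assms by (cases p) auto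
  have "path_weight w (p @ [q]) = (\<Prod>i<Suc n. w (snd ((p @ [q]) ! Suc i - (p @ [q]) ! i)))"
    by (simp add: path_weight_def path_length_def n)
  also have "\<dots> = (\<Prod>i<n. w (snd (p ! Suc i - p ! i))) * w (snd (q - last p))"
    using assms by (simp add: nth_append n last_conv_nth)
  finally show ?thesis by (simp add: path_weight_def path_length_def n)
qed

lemma meanders_0: "meanders B j 0 = {[(0, int j)]}"
proof (intro set_eqI iffI)
  fix p assume "p \<in> meanders B j 0"
  then have "length p = 1" "hd p = (0, int j)"
    by (auto simp: meanders_def path_length_def is_meander_def Suc_le_eq le_Suc_eq diff_is_0_eq)
  then show "p \<in> {[(0, int j)]}" by (cases p) auto
qed (auto simp: meanders_def is_meander_def path_length_def)

lemma meanders_nonempty: "p \<in> meanders B j n \<Longrightarrow> p \<noteq> []"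
  by (auto simp: meanders_def is_meander_def)

text \<open>Decomposition by the last step. A prefix of a meander is a meander, so the only new
  condition is that the last level is nonnegative.\<close>

lemma meanders_Suc:
  "meanders B j (Suc n) =
    (\<lambda>(p, b). p @ [last p + (1, b)]) ` {(p, b) \<in> meanders B j n \<times> B. end_level p + b \<ge> 0}"
proof (intro set_eqI iffI)
  fix p assume p: "p \<in> meanders B j (Suc n)"
  then obtain r q where r: "p = r @ [q]" using meanders_nonempty by (metis rev_exhaust)
  with p have "length r = Suc n" by (simp add: meanders_def path_length_def)
  then have r0: "r \<noteq> []" by auto
  have *: "is_meander ({1} \<times> B) j r" "q - last r \<in> {1} \<times> B" "snd q \<ge> 0"
    using p is_meander_snoc[OF r0] by (auto simp: meanders_def r)
  define b where "b = snd (q - last r)"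
  have "q = last r + (1, b)" "b \<in> B" using *(2) by (auto simp: b_def prod_eq_iff)
  moreover have "r \<in> meanders B j n" using *(1) \<open>length r = Suc n\<close> by (simp add: meanders_def path_length_def)
  ultimately show "p \<in> (\<lambda>(p, b). p @ [last p + (1, b)]) ` {(p, b) \<in> meanders B j n \<times> B. end_level p + b \<ge> 0}"
    using *(3) by (force simp: r end_level_def)
next
  fix p assume "p \<in> (\<lambda>(p, b). p @ [last p + (1, b)]) ` {(p, b) \<in> meanders B j n \<times> B. end_level p + b \<ge> 0}"
  then obtain r b where rb: "r \<in> meanders B j n" "b \<in> B" "end_level r + b \<ge> 0" "p = r @ [last r + (1, b)]"
    by auto
  then have "r \<noteq> []" by (simp add: meanders_nonempty)
  with rb show "p \<in> meanders B j (Suc n)"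
    by (auto simp: meanders_def is_meander_snoc path_length_def end_level_def)
qed

lemma inj_on_snoc_step: "inj_on (\<lambda>(p, b). p @ [last p + (1 :: int, b :: int)]) A"
  by (auto simp: inj_on_def)

lemma finite_meanders: "finite B \<Longrightarrow> finite (meanders B j n)"
proof (induction n)
  case 0
  then show ?case by (simp add: meanders_0)
next
  case (Suc n)
  have "finite (meanders B j n \<times> B)" using Suc by simp
  then have "finite {(p, b) \<in> meanders B j n \<times> B. end_level p + b \<ge> 0}"
    by (rule finite_subset[rotated]) auto
  then show ?case unfolding meanders_Suc by (rule finite_imageI)
qed

section \<open>The step recursion for the generating function\<close>

text \<open>The weights are made complex from the start, so that the recursion lives in the same
  ring as the factorization of the kernel.\<close>

definition meander_coeff :: "int set \<Rightarrow> (int \<Rightarrow> real) \<Rightarrow> nat \<Rightarrow> nat \<Rightarrow> complex laurent_poly" where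
  "meander_coeff B w j n = (\<Sum>p\<in>meanders B j n.
     Poly_Mapping.single (end_level p - int j) (complex_of_real (path_weight w p)))"

lemma meander_coeff_0: "meander_coeff B w j 0 = 1"
  by (simp add: meander_coeff_def meanders_0 end_level_def path_weight_def path_length_def)

lemma meander_coeff_eq_map:
  "meander_coeff B w j n = Poly_Mapping.map complex_of_real (fps_nth (meander_gf B w j) n)"
proof (rule poly_mapping_eqI)
  fix k
  have "Poly_Mapping.lookup (meander_coeff B w j n) k = complex_of_real (Poly_Mapping.lookup (fps_nth (meander_gf B w j) n) k)"
    by (simp add: meander_coeff_def meander_gf_def meanders_def lookup_sum lookup_single when_def
        if_distrib cong: if_cong)
  then show "Poly_Mapping.lookup (meander_coeff B w j n) k =
      Poly_Mapping.lookup (Poly_Mapping.map complex_of_real (fps_nth (meander_gf B w j) n)) k"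
    by (simp add: Poly_Mapping.map.rep_eq when_def)
qed

lemma keys_meander_coeff: "Poly_Mapping.keys (meander_coeff B w j n) \<subseteq> {- int j..}"
proof -
  have "end_level p \<ge> 0" if "p \<in> meanders B j n" for p
    using that by (auto simp: meanders_def is_meander_def end_level_def)
  then have "(\<Union>p\<in>meanders B j n. Poly_Mapping.keys (Poly_Mapping.single (end_level p - int j)
      (complex_of_real (path_weight w p)))) \<subseteq> {- int j..}"
    by (auto split: if_splits)
  then show ?thesis unfolding meander_coeff_def using keys_sum by (rule order_trans[rotated])
qed

text \<open>Multiplication by \<open>P(v)\<close> appends every step to every meander. The surplus
  over the meanders of length \<open>Suc n\<close> consists of the paths whose last step leads below
  level 0, and these have exponents below \<open>- int j\<close>.\<close>

lemma keys_meander_coeff_step: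
  assumes B: "finite B"
  shows "Poly_Mapping.keys (meander_coeff B w j (Suc n) -
      meander_coeff B w j n * (\<Sum>b\<in>B. Poly_Mapping.single b (complex_of_real (w b)))) \<subseteq> {..<- int j}"
proof -
  \<comment> \<open>\<open>t\<close> is the contribution of a meander extended by one step,
    \<open>A\<close> collects all extensions, and \<open>A'\<close> those that are meanders
    again.\<close>
  define t where "t = (\<lambda>(p, b). Poly_Mapping.single (end_level p + b - int j)
      (complex_of_real (path_weight w p * w b)))"
  define A where "A = meanders B j n \<times> B"
  define A' where "A' = {(p, b) \<in> A. end_level p + b \<ge> 0}"
  have fin: "finite A" using B finite_meanders by (simp add: A_def)
  have sub: "A' \<subseteq> A" by (auto simp: A'_def)
  have "meander_coeff B w j n * (\<Sum>b\<in>B. Poly_Mapping.single b (complex_of_real (w b))) = (\<Sum>x\<in>A. t x)"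
    unfolding meander_coeff_def A_def t_def sum_product sum.cartesian_product
    by (intro sum.cong) (auto simp: mult_single algebra_simps)
  moreover have "meander_coeff B w j (Suc n) = (\<Sum>x\<in>A'. t x)"
    unfolding meander_coeff_def meanders_Suc
    by (subst sum.reindex[OF inj_on_snoc_step], intro sum.cong)
      (auto simp: A'_def A_def t_def end_level_def path_weight_snoc meanders_nonempty)
  moreover have "(\<Sum>x\<in>A'. t x) + (\<Sum>x\<in>A - A'. t x) = (\<Sum>x\<in>A. t x)"
    using sum.subset_diff[OF sub fin, of t] by (simp add: add.commute)
  ultimately have "meander_coeff B w j (Suc n) -
      meander_coeff B w j n * (\<Sum>b\<in>B. Poly_Mapping.single b (complex_of_real (w b))) = - (\<Sum>x\<in>A - A'. t x)"
    by (simp add: algebra_simps)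
  moreover have "Poly_Mapping.keys (\<Sum>x\<in>A - A'. t x) \<subseteq> {..<- int j}"
    by (rule order_trans[OF keys_sum]) (auto simp: A'_def t_def split: if_splits)
  ultimately show ?thesis by (auto simp: in_keys_iff)
qed

subsection \<open>The kernel over Laurent polynomials\<close>

definition fps_map :: "('a::zero \<Rightarrow> 'b::zero) \<Rightarrow> 'a fps \<Rightarrow> 'b fps" where
  "fps_map h f = Abs_fps (\<lambda>n. h (fps_nth f n))"

lemma map_puiseux_of_fps:
  assumes "h 0 = 0"
  shows "map_puiseux h (puiseux_of_fps N f) = puiseux_of_fps N (fps_map h f)"
proof -
  have "puiseux_nth (map_puiseux h (puiseux_of_fps N f)) q = puiseux_nth (puiseux_of_fps N (fps_map h f)) q" for q
    using assms by (simp add: map_puiseux.rep_eq puiseux_of_fps_def puiseux_of_fls.rep_eq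
        fls_spread_def fps_map_def)
  then show ?thesis by (simp add: puiseux_nth_inject[symmetric] fun_eq_iff)
qed

definition laurent_lift :: "complex fps \<Rightarrow> complex laurent_poly fps" where
  "laurent_lift = fps_map (Poly_Mapping.single 0)"

lemma lift_v_of_fps: "lift_v (puiseux_of_fps N f) = puiseux_of_fps N (laurent_lift f)"
  by (simp add: lift_v_def laurent_lift_def map_puiseux_of_fps)

lemma laurent_lift_0: "laurent_lift 0 = 0"
  and laurent_lift_1: "laurent_lift 1 = 1"
  and laurent_lift_add: "laurent_lift (f + g) = laurent_lift f + laurent_lift g"
  and laurent_lift_uminus: "laurent_lift (- f) = - laurent_lift f"
  and laurent_lift_const: "laurent_lift (fps_const a) = fps_const (Poly_Mapping.single 0 a)"
  by (rule fps_ext, simp add: laurent_lift_def fps_map_def single_add single_uminus)+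

lemma laurent_lift_mult: "laurent_lift (f * g) = laurent_lift f * laurent_lift g"
proof (rule fps_ext)
  fix n
  have "Poly_Mapping.single 0 (\<Sum>i\<in>I. a i) = (\<Sum>i\<in>I. Poly_Mapping.single (0::int) (a i))"
    for a :: "nat \<Rightarrow> complex" and I
    by (induction I rule: infinite_finite_induct) (simp_all add: single_add)
  then show "fps_nth (laurent_lift (f * g)) n = fps_nth (laurent_lift f * laurent_lift g) n"
    by (simp add: laurent_lift_def fps_map_def fps_mult_nth mult_single)
qed

lemma laurent_lift_X_power: "laurent_lift (fps_X ^ n) = fps_X ^ n"
  by (rule fps_ext) (simp add: laurent_lift_def fps_map_def fps_X_power_nth)

lemma levels_in_laurent_lift: "levels_in {0} (laurent_lift f)"
  by (simp add: levels_in_def laurent_lift_def fps_map_def)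

text \<open>Lifted coefficients are free of \<open>v\<close>, so no negative power can arise. This
  will be applied to the cofactor \<open>U\<close> evaluated at \<open>v\<close>.\<close>

lemma levels_in_poly_laurent_lift:
  assumes "levels_in {0..} v"
  shows "levels_in {0..} (poly (map_poly laurent_lift p) v)"
proof (induction p)
  case (pCons a p)
  have "levels_in {0..} (laurent_lift a)" by (rule levels_in_mono[OF levels_in_laurent_lift]) simp
  moreover have "levels_in {0..} (v * poly (map_poly laurent_lift p) v)"
    using assms pCons.IH by (rule levels_in_mult) auto
  ultimately show ?case by (simp add: map_poly_pCons laurent_lift_0 levels_in_add)
qed simp

text \<open>Integer powers of \<open>v\<close> belong to the coefficient ring, so dividing a root by
  \<open>v\<close> does not leave the power series in \<open>t\<close>.\<close>

definition v_power :: "int \<Rightarrow> complex laurent_poly fps" where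
  "v_power k = fps_const (Poly_Mapping.single k 1)"

lemma v_power_0: "v_power 0 = 1"
  by (simp add: v_power_def)

lemma v_power_mult: "v_power k * v_power l = v_power (k + l)"
  by (simp add: v_power_def mult_single)

lemma v_power_power: "v_power k ^ n = v_power (int n * k)"
  by (induction n) (simp_all add: v_power_0 v_power_mult algebra_simps)

lemma puiseux_v_eq: "N > 0 \<Longrightarrow> puiseux_v = puiseux_of_fps N (v_power 1)"
  by (simp add: puiseux_v_def puiseux_const_eq v_power_def)

lemma inverse_puiseux_v: "N > 0 \<Longrightarrow> inverse puiseux_v = puiseux_of_fps N (v_power (-1))"
  by (rule puiseux_inverse_unique)
    (simp add: puiseux_v_eq puiseux_of_fps_mult[symmetric] v_power_mult v_power_0)

lemma puiseux_v_powi: "N > 0 \<Longrightarrow> puiseux_v powi b = puiseux_of_fps N (v_power b)"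
  unfolding power_int_def inverse_puiseux_v
  by (simp add: puiseux_v_eq puiseux_of_fps_power[symmetric] v_power_power)

definition char_laurent :: "int set \<Rightarrow> (int \<Rightarrow> real) \<Rightarrow> complex laurent_poly" where
  "char_laurent B w = (\<Sum>b\<in>B. Poly_Mapping.single b (complex_of_real (w b)))"

lemma fps_const_sum: "fps_const (\<Sum>i\<in>I. f i) = (\<Sum>i\<in>I. fps_const (f i :: 'a::comm_ring_1))"
  by (induction I rule: infinite_finite_induct) (simp_all add: fps_const_add[symmetric] del: fps_const_add)

lemma step_char_poly_v:
  assumes "N > 0"
  shows "step_char_poly B (\<lambda>b. lift_v (real_const (w b))) puiseux_v =
    puiseux_of_fps N (fps_const (char_laurent B w))"
  by (simp add: step_char_poly_def real_const_def puiseux_const_eq[OF assms] lift_v_of_fps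
      laurent_lift_const puiseux_v_powi[OF assms] puiseux_of_fps_mult[OF assms, symmetric]
      v_power_def mult_single puiseux_of_fps_sum[symmetric] char_laurent_def fps_const_sum)

text \<open>Evaluate the factorization at \<open>v\<close> and multiply by the power
  \<open>- int c\<close> of \<open>v\<close>. As there are exactly \<open>c\<close> linear factors,
  each receives one factor \<open>1/v\<close> and \<open>v - s\<close> becomes
  \<open>1 - s/v\<close>.\<close>

lemma kernel_factorization_v:
  assumes B: "\<And>b. b \<in> B \<Longrightarrow> b \<ge> - int c" and S: "card S = c"
    and U: "kernel_poly B (\<lambda>b. complex_of_real (w b)) c = (\<Prod>s\<in>S. [:-s, 1:]) * U"
  shows "1 - fps_X ^ c * fps_const (char_laurent B w) =
    (\<Prod>s\<in>S. 1 - laurent_lift s * v_power (-1)) * poly (map_poly laurent_lift U) (v_power 1)"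
proof -
  note hom = laurent_lift_0 laurent_lift_1 laurent_lift_add laurent_lift_mult
  let ?ev = "\<lambda>p. poly (map_poly laurent_lift p) (v_power 1)"
  have "?ev (kernel_poly B (\<lambda>b. complex_of_real (w b)) c) =
      v_power (int c) - (\<Sum>b\<in>B. fps_const (Poly_Mapping.single 0 (complex_of_real (w b))) * fps_X ^ c
        * v_power (b + int c))"
  proof -
    have "v_power 1 ^ nat (b + int c) = v_power (b + int c)" if "b \<in> B" for b
      using B[OF that] by (simp add: v_power_power)
    then show ?thesis
      by (simp add: poly_map_kernel_poly hom v_power_power[of _ c] laurent_lift_const
          laurent_lift_X_power cong: sum.cong)
  qed
  then have "v_power (- int c) * ?ev (kernel_poly B (\<lambda>b. complex_of_real (w b)) c) =
      1 - (\<Sum>b\<in>B. fps_X ^ c * fps_const (Poly_Mapping.single b (complex_of_real (w b))))"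
    by (simp add: right_diff_distrib sum_distrib_left v_power_mult v_power_0)
       (simp add: v_power_def mult_ac mult_single)
  also have "\<dots> = 1 - fps_X ^ c * fps_const (char_laurent B w)"
    by (simp add: char_laurent_def fps_const_sum sum_distrib_left)
  finally have "1 - fps_X ^ c * fps_const (char_laurent B w) =
      v_power (- int c) * ?ev (kernel_poly B (\<lambda>b. complex_of_real (w b)) c)" by simp
  also have "?ev (kernel_poly B (\<lambda>b. complex_of_real (w b)) c) =
      (\<Prod>s\<in>S. v_power 1 - laurent_lift s) * ?ev U"
    unfolding U by (simp add: poly_map_poly_mult poly_map_poly_prod hom map_poly_pCons laurent_lift_uminus)
  also have "v_power (- int c) = (\<Prod>s\<in>S. v_power (-1))"
    by (simp add: S v_power_power)
  finally have "1 - fps_X ^ c * fps_const (char_laurent B w) =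
      (\<Prod>s\<in>S. v_power (-1) * (v_power 1 - laurent_lift s)) * ?ev U"
    by (simp only: prod.distrib mult.assoc)
  then show ?thesis by (simp add: right_diff_distrib v_power_mult v_power_0 mult.commute)
qed

lemma puiseux_of_real_meander_gf:
  assumes "N > 0"
  shows "puiseux_of_real_gf (meander_gf B w j) =
    puiseux_of_fps N (fps_dilate N (Abs_fps (meander_coeff B w j)))"
proof -
  have "puiseux_of_real_gf (meander_gf B w j) =
      puiseux_of_fps 1 (fps_map (Poly_Mapping.map complex_of_real) (meander_gf B w j))"
    unfolding puiseux_of_real_gf_def puiseux_of_fps_def[symmetric]
    by (rule map_puiseux_of_fps) (simp add: poly_mapping_eq_iff fun_eq_iff Poly_Mapping.map.rep_eq)
  then show ?thesis
    unfolding puiseux_of_fps_def[of 1] puiseux_of_fls_1_fps[OF assms]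
    by (simp add: fps_map_def meander_coeff_eq_map[symmetric])
qed

text \<open>With \<open>z = t ^ c\<close> only indices divisible by \<open>c\<close> matter: index 0
  gives the empty path, which the subtracted 1 cancels, and every later multiple of \<open>c\<close>
  is an instance of the step recursion.\<close>

lemma levels_in_kernel_equation:
  assumes B: "finite B" and c: "c > 0"
  shows "levels_in {..<- int j} (fps_dilate c (Abs_fps (meander_coeff B w j)) *
    (1 - fps_X ^ c * fps_const (char_laurent B w)) - 1)"
  unfolding levels_in_def
proof
  fix n
  let ?T = "fps_dilate c (Abs_fps (meander_coeff B w j))"
  have "?T * (1 - fps_X ^ c * fps_const (char_laurent B w)) - 1 =
      ?T - fps_X ^ c * (?T * fps_const (char_laurent B w)) - 1"
    by (simp add: algebra_simps)
  then have nth: "fps_nth (?T * (1 - fps_X ^ c * fps_const (char_laurent B w)) - 1) n =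
      fps_nth ?T n - (if n < c then 0 else fps_nth ?T (n - c) * char_laurent B w) - (if n = 0 then 1 else 0)"
    by (simp add: fps_X_power_mult_nth)
  show "Poly_Mapping.keys (fps_nth (?T * (1 - fps_X ^ c * fps_const (char_laurent B w)) - 1) n) \<subseteq> {..<- int j}"
  proof (cases "c dvd n")
    case True
    then obtain m where m: "n = c * m" by (auto elim: dvdE)
    show ?thesis
    proof (cases m)
      case 0
      then show ?thesis unfolding nth using c by (simp add: m fps_dilate_def meander_coeff_0)
    next
      case (Suc k)
      then have "n - c = c * k" by (simp add: m)
      then show ?thesis using c keys_meander_coeff_step[OF B, of w j k]
        unfolding nth by (simp add: m Suc fps_dilate_def char_laurent_def)
    qed
  next
    case False
    \<comment> \<open>Neither \<open>n\<close> nor \<open>n - c\<close> is a multiple of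
      \<open>c\<close>, so both coefficients of the dilated series are zero.\<close>
    then have "n \<noteq> 0" "\<not> n < c \<Longrightarrow> \<not> c dvd n - c"
      by (auto simp: dvd_minus_self intro: gr0I)
    with False show ?thesis unfolding nth by (simp add: fps_dilate_def)
  qed
qed

lemma meander_kernel_identity:
  fixes x :: "nat \<Rightarrow> complex laurent_poly fps"
  assumes B: "finite B" and c: "c > 0"
    and x: "\<And>l. l \<in> {1..c} \<Longrightarrow> levels_in {-1} (x l)" "\<And>l. l \<in> {1..c} \<Longrightarrow> fps_nth (x l) 0 = 0"
    and U: "levels_in {0..} U"
    and K: "1 - fps_X ^ c * fps_const (char_laurent B w) = (\<Prod>l=1..c. 1 - x l) * U"
  shows "fps_dilate c (Abs_fps (meander_coeff B w j)) * (1 - fps_X ^ c * fps_const (char_laurent B w)) =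
    (\<Sum>f=0..j. complete_homogeneous c f x) * (\<Prod>l=1..c. 1 - x l)"
proof -
  let ?T = "fps_dilate c (Abs_fps (meander_coeff B w j))"
  let ?\<Pi> = "\<Prod>l=1..c. 1 - x l" and ?S = "\<Sum>f=0..j. complete_homogeneous c f x"
  \<comment> \<open>Both sides of the claim contain the product, and their difference is the product
    times \<open>G\<close>; thus \<open>G = 0\<close> suffices.\<close>
  define G where "G = ?T * U - ?S"
  have eq: "?\<Pi> * G = ?T * (1 - fps_X ^ c * fps_const (char_laurent B w)) - 1 - (?S * ?\<Pi> - 1)"
    unfolding K G_def by (simp add: algebra_simps)
  have "levels_in {..<- int j} (?\<Pi> * G)"
    unfolding eq
    by (rule levels_in_diff[OF levels_in_kernel_equation[OF B c] levels_in_sum_complete_homogeneous[OF x(1)]])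
  moreover have "levels_in {..0} ?\<Pi>" by (rule levels_in_prod_one_minus) (rule x(1))
  \<comment> \<open>At \<open>t = 0\<close> every \<open>x l\<close> vanishes, so the product can be
    cancelled by \<open>levels_in_cancel_unipotent\<close>.\<close>
  moreover have "fps_nth ?\<Pi> 0 = 1"
  proof -
    have "fps_nth (\<Prod>l\<in>I. f l) 0 = (\<Prod>l\<in>I. fps_nth (f l) 0)"
      for I and f :: "nat \<Rightarrow> complex laurent_poly fps"
      by (induction I rule: infinite_finite_induct) simp_all
    then show ?thesis by (simp add: x(2))
  qed
  ultimately have neg: "levels_in {..<- int j} G"
    by (rule levels_in_cancel_unipotent)
  have "levels_in {- int j..} ?T"
    using keys_meander_coeff by (auto simp: levels_in_def fps_dilate_def)
  then have "levels_in {- int j..} (?T * U)" using U by (rule levels_in_mult) auto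
  moreover have "levels_in {- int j..} ?S"
  proof (rule levels_in_sum)
    fix f assume "f \<in> {0..j}"
    then show "levels_in {- int j..} (complete_homogeneous c f x)"
      using levels_in_mono[OF levels_in_complete_homogeneous[OF x(1)], where L = "{- int j..}"] by simp
  qed
  ultimately have "levels_in {- int j..} G" unfolding G_def by (rule levels_in_diff)
  with neg have "G = 0" by (rule levels_in_disjoint) auto
  with eq show ?thesis by simp
qed

text \<open>The cardinality statement guarantees that enumerations \<open>X\<close> of the small
  solutions exist, and the formula holds for each of them.\<close>

theorem corollary4:
  fixes B :: "int set" and w :: "int \<Rightarrow> real" and c j :: nat
  assumes "finite B" and "B \<noteq> {}"
    and "\<And>b. b \<in> B \<Longrightarrow> w b > 0"
    and "int c = - Min B" and "c \<ge> 1"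
  shows "card (small_solutions B w) = c \<and>
    (\<forall>X. bij_betw X {1..c} (small_solutions B w) \<longrightarrow>
      puiseux_of_real_gf (meander_gf B w j) =
        1 / (1 - puiseux_Z * step_char_poly B (\<lambda>b. lift_v (real_const (w b))) puiseux_v)
        * (\<Sum>f=0..j. complete_homogeneous c f (\<lambda>l. lift_v (X l) / puiseux_v))
        * (\<Prod>l=1..c. 1 - lift_v (X l) / puiseux_v))"
proof -
  have c0: "c > 0" using assms(5) by simp
  have ge: "b \<ge> - int c" if "b \<in> B" for b using Min_le[OF assms(1) that] assms(4) by simp
  obtain S U where S: "finite S" "card S = c" "\<And>s. s \<in> S \<Longrightarrow> fps_nth s 0 = 0"
    and U: "kernel_poly B (\<lambda>b. complex_of_real (w b)) c = (\<Prod>s\<in>S. [:-s, 1:]) * U"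
    and small: "small_solutions B w = puiseux_of_fps c ` S"
    by (rule small_solutions_factorization[of B w c]) (use assms in blast)+
  have inj: "inj_on (puiseux_of_fps c) S" using inj_puiseux_of_fps[OF c0] by (rule inj_on_subset) simp
  let ?K = "1 - fps_X ^ c * fps_const (char_laurent B w)"
  let ?h = "puiseux_of_fps c :: complex laurent_poly fps \<Rightarrow> _"
  have K: "1 - puiseux_Z * step_char_poly B (\<lambda>b. lift_v (real_const (w b))) puiseux_v = ?h ?K"
    by (simp add: step_char_poly_v[OF c0] puiseux_Z_eq[OF c0] puiseux_of_fps_diff puiseux_of_fps_mult c0)
  \<comment> \<open>Laurent polynomials do not form a field, so the inverse is built from an inverse
    of the constant term; that term is 1 because \<open>c > 0\<close>, whence the second argument
    1.\<close>
  have "?K * fps_right_inverse ?K 1 = 1"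
    by (rule fps_right_inverse) (use c0 in \<open>simp add: fps_X_power_nth\<close>)
  then have K1: "?h ?K * ?h (fps_right_inverse ?K 1) = 1"
    unfolding puiseux_of_fps_mult[OF c0, symmetric] by (simp add: c0)
  then have inv: "inverse (?h ?K) = ?h (fps_right_inverse ?K 1)" by (rule puiseux_inverse_unique)
  have "puiseux_of_real_gf (meander_gf B w j) =
        1 / (1 - puiseux_Z * step_char_poly B (\<lambda>b. lift_v (real_const (w b))) puiseux_v)
        * (\<Sum>f=0..j. complete_homogeneous c f (\<lambda>l. lift_v (X l) / puiseux_v))
        * (\<Prod>l=1..c. 1 - lift_v (X l) / puiseux_v)"
    if X: "bij_betw X {1..c} (small_solutions B w)" for X
  proof -
    \<comment> \<open>The given enumeration of small solutions is pulled back to the power series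
      roots in \<open>S\<close>.\<close>
    define s where "s = (\<lambda>l. inv_into S (puiseux_of_fps c) (X l))"
    have bij: "bij_betw s {1..c} S"
      using bij_betw_trans[OF X[unfolded small] bij_betw_inv_into[OF inj_on_imp_bij_betw[OF inj]]]
      by (simp add: s_def comp_def)
    have X_eq: "X l = puiseux_of_fps c (s l)" if "l \<in> {1..c}" for l
      using bij_betwE[OF X] that by (simp add: s_def small f_inv_into_f)
    \<comment> \<open>This is the quotient of the small solution \<open>X l\<close> by
      \<open>v\<close>, written as a power series in \<open>t\<close>.\<close>
    define x where "x = (\<lambda>l. laurent_lift (s l) * v_power (-1))"
    have x_eq: "lift_v (X l) / puiseux_v = ?h (x l)" if "l \<in> {1..c}" for l
      by (simp add: X_eq[OF that] lift_v_of_fps divide_puiseux_def inverse_puiseux_v[OF c0] x_def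
          puiseux_of_fps_mult[OF c0])
    have fact: "?K = (\<Prod>l=1..c. 1 - x l) * poly (map_poly laurent_lift U) (v_power 1)"
      using kernel_factorization_v[OF ge S(2) U]
        prod.reindex_bij_betw[OF bij, of "\<lambda>s. 1 - laurent_lift s * v_power (-1)"]
      unfolding x_def by simp
    have "fps_dilate c (Abs_fps (meander_coeff B w j)) * ?K =
        (\<Sum>f=0..j. complete_homogeneous c f x) * (\<Prod>l=1..c. 1 - x l)"
    proof (rule meander_kernel_identity[OF assms(1) c0 _ _ _ fact])
      show "levels_in {-1} (x l)" for l
        unfolding x_def v_power_def
        by (rule levels_in_mult[OF levels_in_laurent_lift levels_in_const[of _ "{-1}"]]) auto
      show "fps_nth (x l) 0 = 0" if "l \<in> {1..c}" for l
        using S(3)[OF bij_betwE[OF bij, rule_format, OF that]] by (simp add: x_def laurent_lift_def fps_map_def)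
      show "levels_in {0..} (poly (map_poly laurent_lift U) (v_power 1))"
        by (intro levels_in_poly_laurent_lift) (simp add: v_power_def levels_in_const)
    qed
    then have main: "puiseux_of_real_gf (meander_gf B w j) * ?h ?K =
        (\<Sum>f=0..j. complete_homogeneous c f (\<lambda>l. ?h (x l))) * (\<Prod>l=1..c. 1 - ?h (x l))"
      unfolding puiseux_of_real_meander_gf[OF c0] puiseux_of_fps_mult[OF c0, symmetric]
      by (simp add: puiseux_of_fps_mult puiseux_of_fps_sum puiseux_of_fps_prod puiseux_of_fps_diff
          puiseux_of_fps_complete_homogeneous c0)
    \<comment> \<open>The index lists have entries in \<open>{1..c}\<close> only, which is where the
      two families of arguments agree.\<close>
    have ch: "complete_homogeneous c f (\<lambda>l. lift_v (X l) / puiseux_v) =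
        complete_homogeneous c f (\<lambda>l. ?h (x l))" for f
      unfolding complete_homogeneous_def
      by (intro sum.cong refl arg_cong[of _ _ prod_list] map_cong) (use x_eq in blast)
    have "puiseux_of_real_gf (meander_gf B w j) =
        puiseux_of_real_gf (meander_gf B w j) * (?h ?K * ?h (fps_right_inverse ?K 1))"
      by (simp only: K1 mult_1_right)
    also have "\<dots> = ?h (fps_right_inverse ?K 1) * (puiseux_of_real_gf (meander_gf B w j) * ?h ?K)"
      by (simp only: mult_ac)
    also have "\<dots> = 1 / ?h ?K * (\<Sum>f=0..j. complete_homogeneous c f (\<lambda>l. ?h (x l)))
        * (\<Prod>l=1..c. 1 - ?h (x l))"
      unfolding main divide_puiseux_def inv by (simp only: mult_1_left mult.assoc)
    also have "(\<Prod>l=1..c. 1 - ?h (x l)) = (\<Prod>l=1..c. 1 - lift_v (X l) / puiseux_v)"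
      by (intro prod.cong) (simp_all only: x_eq)
    finally show ?thesis unfolding K ch .
  qed
  moreover have "card (small_solutions B w) = c"
    unfolding small using card_image[OF inj] S(2) by simp
  ultimately show ?thesis by blast
qed

end
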